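(* Let $(M,\nabla,\circ,e,\nabla^*,*,E)$ be a bi-flat F-manifold. Let $L=E\circ$ be the endomorphism of $\mathcal{T}_M$ given by multiplication by $E$, and for a constant $\lambda$ let $L_\lambda=L-\lambda I$. Then for any fixed $\lambda$ the connection on $\mathcal{T}_M$ defined by $$\nabla^{GM}_XY=\nabla^*_XY+\lambda\left(\nabla^*_{L_{\lambda}^{-1}X}Y-\nabla_{L_{\lambda}^{-1}X}Y\right)$$ is flat and torsionless on the open set where $L_\lambda$ is invertible (inside the locus where $\nabla^*$ is defined).
   Context: Conventions: $M$ is a smooth, real analytic or complex manifold, $\mathcal{T}_M$ its tangent sheaf, $\mathcal{O}_M$ its structure sheaf; in the complex case everything is holomorphic. $X,Y,Z,W$ denote arbitrary local sections of $\mathcal{T}_M$; $\lambda$ is a constant (real or complex accordingly). F-manifold $(M,\circ,e)$: $\circ$ is an $\mathcal{O}_M$-bilinear commutative associative product on $\mathcal{T}_M$ with unit a global vector field $e$ ($e\circ X=X$), satisfying $[X\circ Y,W\circ Z]-[X\circ Y,Z]\circ W-[X\circ Y,W]\circ Z-X\circ[Y,Z\circ W]+X\circ[Y,Z]\circ W+X\circ[Y,W]\circ Z-Y\circ[X,Z\circ W]+Y\circ[X,Z]\circ W+Y\circ[X,W]\circ Z=0$. Flat F-manifold $(M,\nabla,\circ,e)$: an F-manifold with a connection $\nabla$ on $\mathcal{T}_M$ such that for every constant $\lambda$ the connection $(X,Y)\mapsto \nabla_XY-\lambda X\circ Y$ is flat and torsionless, and $\nabla e=0$. Euler vector field of an F-manifold: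 a global vector field $E$ with $[e,E]=e$ and $\mathcal{L}_E\circ=\circ$, i.e. $[E,X\circ Y]-[E,X]\circ Y-X\circ[E,Y]=X\circ Y$. Bi-flat F-manifold $(M,\nabla,\circ,e,\nabla^*,*,E)$: (i) $(\nabla,\circ,e)$ is a flat F-structure on $M$; (ii) $E$ is an Euler vector field for $(M,\circ,e)$ and the operator $E\circ$ is invertible at generic points, i.e. on an open dense subset $U$; (iii) on $U$, $X*Y=(E\circ)^{-1}(X\circ Y)$; (iv) $(\nabla^*,*,E)$ is a flat F-structure on $U$ (with unit $E$, so $\nabla^*E=0$); (v) $(d_\nabla-d_{\nabla^*})(X\circ)=0$ for all local $X$, i.e. $\nabla_Y(X\circ Z)-\nabla_Z(X\circ Y)=\nabla^*_Y(X\circ Z)-\nabla^*_Z(X\circ Y)$. The connection $\nabla^*$ and the product $*$ are defined only on $U$. *)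

theory Defs
  imports "HOL-Analysis.Analysis" "HOL-Library.Function_Algebras"
begin

section \<open>Manifolds\<close>

text \<open>
  Throughout, \<open>'k\<close> is the field of scalars. By the Gelfand-Mazur theorem a \<open>real_normed_field\<close>
  is, up to isomorphism, the reals or the complex numbers, so that the three kinds of manifold
  are obtained as follows:
  \<^item> smooth manifolds: \<open>'k = real\<close> and \<open>Smooth\<close>;
  \<^item> real analytic manifolds: \<open>'k = real\<close> and \<open>Analytic\<close>;
  \<^item> complex manifolds: \<open>'k = complex\<close> and \<open>Smooth\<close> or, equivalently, \<open>Analytic\<close>,
    because all derivatives are taken over \<open>'k\<close>: infinitely often complex differentiable functions
    are the holomorphic ones.
\<close>

datatype regularity = Smooth | Analytic

definition partial_deriv :: "'n \<Rightarrow> ('k::real_normed_field ^ 'n::finite \<Rightarrow> 'k) \<Rightarrow> 'k ^ 'n \<Rightarrow> 'k" where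
  "partial_deriv i f x = deriv (\<lambda>t. f (x + axis i t)) 0"

primrec Ck_on :: "nat \<Rightarrow> ('k::real_normed_field ^ 'n::finite) set \<Rightarrow> ('k ^ 'n \<Rightarrow> 'k) \<Rightarrow> bool" where
  "Ck_on 0 V f \<longleftrightarrow> continuous_on V f"
| "Ck_on (Suc r) V f \<longleftrightarrow> continuous_on V f \<and>
     (\<forall>i. (\<forall>x\<in>V. (\<lambda>t. f (x + axis i t)) field_differentiable (at 0)) \<and> Ck_on r V (partial_deriv i f))"

definition power_series_term ::
  "(('n::finite \<Rightarrow> nat) \<Rightarrow> 'k::real_normed_field) \<Rightarrow> 'k ^ 'n \<Rightarrow> ('n \<Rightarrow> nat) \<Rightarrow> 'k" where
  "power_series_term c z \<alpha> = c \<alpha> * (\<Prod>i\<in>UNIV. (z $ i) ^ \<alpha> i)"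

definition analytic_at_point :: "('k::real_normed_field ^ 'n::finite \<Rightarrow> 'k) \<Rightarrow> 'k ^ 'n \<Rightarrow> bool" where
  "analytic_at_point f a \<longleftrightarrow> (\<exists>c. \<exists>\<epsilon>>0. \<forall>x\<in>ball a \<epsilon>.
     (\<lambda>\<alpha>. norm (power_series_term c (x - a) \<alpha>)) summable_on UNIV \<and>
     (power_series_term c (x - a) has_sum f x) UNIV)"

fun regular_on ::
  "regularity \<Rightarrow> ('k::real_normed_field ^ 'n::finite) set \<Rightarrow> ('k ^ 'n \<Rightarrow> 'k) \<Rightarrow> bool" where
  "regular_on Smooth V f \<longleftrightarrow> (\<forall>r. Ck_on r V f)"
| "regular_on Analytic V f \<longleftrightarrow> (\<forall>a\<in>V. analytic_at_point f a)"

text \<open>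
  The manifold is the whole type \<open>'m\<close>; an atlas is a set of charts \<open>(d, \<phi>)\<close>, where only the values
  of \<open>\<phi>\<close> on its domain \<open>d\<close> matter.
\<close>

definition manifold ::
  "regularity \<Rightarrow> ('m::{t2_space, second_countable_topology} set \<times> ('m \<Rightarrow> 'k::real_normed_field ^ 'n::finite)) set
   \<Rightarrow> bool" where
  "manifold reg \<A> \<longleftrightarrow>
     (\<forall>(d, \<phi>)\<in>\<A>. open d \<and> open (\<phi> ` d) \<and> (\<exists>\<psi>. homeomorphism d (\<phi> ` d) \<phi> \<psi>)) \<and>
     (\<Union>(d, \<phi>)\<in>\<A>. d) = UNIV \<and>
     (\<forall>(d, \<phi>)\<in>\<A>. \<forall>(d', \<phi>')\<in>\<A>. \<forall>i.
        regular_on reg (\<phi> ` (d \<inter> d')) (\<lambda>x. \<phi>' (inv_into d \<phi> x) $ i))"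

text \<open>
  Sections over \<open>V\<close> of the structure sheaf are represented by total functions of which only the
  values on \<open>V\<close> matter.
\<close>

type_synonym ('m, 'k) function_sheaf = "'m set \<Rightarrow> ('m \<Rightarrow> 'k) set"

definition structure_sheaf ::
  "regularity \<Rightarrow> ('m::{t2_space, second_countable_topology} set \<times> ('m \<Rightarrow> 'k::real_normed_field ^ 'n::finite)) set
   \<Rightarrow> ('m, 'k) function_sheaf" where
  "structure_sheaf reg \<A> V =
     {f. \<forall>(d, \<phi>)\<in>\<A>. regular_on reg (\<phi> ` (d \<inter> V)) (\<lambda>x. f (inv_into d \<phi> x))}"

section \<open>The tangent sheaf\<close>

definition regular_at ::
  "('m::topological_space, 'k) function_sheaf \<Rightarrow> 'm \<Rightarrow> ('m \<Rightarrow> 'k) \<Rightarrow> bool" where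
  "regular_at \<O> p f \<longleftrightarrow> (\<exists>V. open V \<and> p \<in> V \<and> f \<in> \<O> V)"

text \<open>
  Tangent vectors at \<open>p\<close> are the \<open>'k\<close>-linear derivations of the algebra of germs at \<open>p\<close>. They are
  totalized by the value 0 on functions that have no regular germ at \<open>p\<close>; in this way equality of
  tangent vectors and vector fields is equality in HOL. The operations \<open>+\<close>, \<open>-\<close>, \<open>*\<close> and 0 on
  functions are the pointwise ones.
\<close>

definition tangent_vector ::
  "('m::topological_space, 'k::real_normed_field) function_sheaf \<Rightarrow> 'm \<Rightarrow> (('m \<Rightarrow> 'k) \<Rightarrow> 'k) \<Rightarrow> bool" where
  "tangent_vector \<O> p v \<longleftrightarrow>
     (\<forall>f. \<not> regular_at \<O> p f \<longrightarrow> v f = 0) \<and>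
     (\<forall>f g. regular_at \<O> p f \<longrightarrow> (\<forall>\<^sub>F q in nhds p. f q = g q) \<longrightarrow> v f = v g) \<and>
     (\<forall>f g. regular_at \<O> p f \<longrightarrow> regular_at \<O> p g \<longrightarrow> v (f + g) = v f + v g) \<and>
     (\<forall>c f. regular_at \<O> p f \<longrightarrow> v (\<lambda>q. c * f q) = c * v f) \<and>
     (\<forall>f g. regular_at \<O> p f \<longrightarrow> regular_at \<O> p g \<longrightarrow> v (f * g) = f p * v g + g p * v f)"

type_synonym ('m, 'k) vfield = "'m \<Rightarrow> ('m \<Rightarrow> 'k) \<Rightarrow> 'k"

text \<open>Sections of the tangent sheaf over \<open>V\<close>, extended by 0 outside \<open>V\<close>.\<close>

definition vector_fields ::
  "('m::topological_space, 'k::real_normed_field) function_sheaf \<Rightarrow> 'm set \<Rightarrow> ('m, 'k) vfield set" where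
  "vector_fields \<O> V = {X.
     (\<forall>p\<in>V. tangent_vector \<O> p (X p)) \<and> (\<forall>p. p \<notin> V \<longrightarrow> X p = 0) \<and>
     (\<forall>W f. open W \<longrightarrow> W \<subseteq> V \<longrightarrow> f \<in> \<O> W \<longrightarrow> (\<lambda>p. X p f) \<in> \<O> W)}"

definition res :: "'m set \<Rightarrow> ('m, 'k::real_normed_field) vfield \<Rightarrow> ('m, 'k) vfield" where
  "res W X = (\<lambda>p. if p \<in> W then X p else 0)"

definition act :: "('m, 'k) vfield \<Rightarrow> ('m \<Rightarrow> 'k) \<Rightarrow> 'm \<Rightarrow> 'k" where
  "act X f = (\<lambda>p. X p f)"

definition scale :: "('m \<Rightarrow> 'k::real_normed_field) \<Rightarrow> ('m, 'k) vfield \<Rightarrow> ('m, 'k) vfield"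
    (infixr "\<odot>" 75) where
  "g \<odot> X = (\<lambda>p f. g p * X p f)"

text \<open>The case distinction maintains the convention on functions without a regular germ.\<close>

definition lie ::
  "('m::topological_space, 'k::real_normed_field) function_sheaf \<Rightarrow>
   ('m, 'k) vfield \<Rightarrow> ('m, 'k) vfield \<Rightarrow> ('m, 'k) vfield" where
  "lie \<O> X Y = (\<lambda>p f. if regular_at \<O> p f then X p (act Y f) - Y p (act X f) else 0)"

section \<open>Products and connections\<close>

text \<open>
  Operations on local vector fields are families indexed by the open set over which the arguments
  are defined.
\<close>

type_synonym ('m, 'k) operation = "'m set \<Rightarrow> ('m, 'k) vfield \<Rightarrow> ('m, 'k) vfield \<Rightarrow> ('m, 'k) vfield"
type_synonym ('m, 'k) endo = "'m set \<Rightarrow> ('m, 'k) vfield \<Rightarrow> ('m, 'k) vfield"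

definition biadditive_sheaf_map ::
  "('m::topological_space, 'k::real_normed_field) function_sheaf \<Rightarrow> 'm set \<Rightarrow> ('m, 'k) operation \<Rightarrow> bool" where
  "biadditive_sheaf_map \<O> U B \<longleftrightarrow> (\<forall>V. open V \<longrightarrow> V \<subseteq> U \<longrightarrow>
     (\<forall>X\<in>vector_fields \<O> V. \<forall>Y\<in>vector_fields \<O> V.
        B V X Y \<in> vector_fields \<O> V \<and>
        (\<forall>W. open W \<longrightarrow> W \<subseteq> V \<longrightarrow> res W (B V X Y) = B W (res W X) (res W Y)) \<and>
        (\<forall>Z\<in>vector_fields \<O> V.
           B V (X + Y) Z = B V X Z + B V Y Z \<and> B V Z (X + Y) = B V Z X + B V Z Y)))"

definition bilinear_product ::
  "('m::topological_space, 'k::real_normed_field) function_sheaf \<Rightarrow> 'm set \<Rightarrow> ('m, 'k) operation \<Rightarrow> bool" where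
  "bilinear_product \<O> U m \<longleftrightarrow> biadditive_sheaf_map \<O> U m \<and>
     (\<forall>V. open V \<longrightarrow> V \<subseteq> U \<longrightarrow>
        (\<forall>f\<in>\<O> V. \<forall>X\<in>vector_fields \<O> V. \<forall>Y\<in>vector_fields \<O> V.
           m V (f \<odot> X) Y = f \<odot> m V X Y \<and> m V X (f \<odot> Y) = f \<odot> m V X Y))"

definition connection ::
  "('m::topological_space, 'k::real_normed_field) function_sheaf \<Rightarrow> 'm set \<Rightarrow> ('m, 'k) operation \<Rightarrow> bool" where
  "connection \<O> U D \<longleftrightarrow> biadditive_sheaf_map \<O> U D \<and>
     (\<forall>V. open V \<longrightarrow> V \<subseteq> U \<longrightarrow>
        (\<forall>f\<in>\<O> V. \<forall>X\<in>vector_fields \<O> V. \<forall>Y\<in>vector_fields \<O> V.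
           D V (f \<odot> X) Y = f \<odot> D V X Y \<and> D V X (f \<odot> Y) = f \<odot> D V X Y + act X f \<odot> Y))"

definition flat ::
  "('m::topological_space, 'k::real_normed_field) function_sheaf \<Rightarrow> 'm set \<Rightarrow> ('m, 'k) operation \<Rightarrow> bool" where
  "flat \<O> U D \<longleftrightarrow> (\<forall>V. open V \<longrightarrow> V \<subseteq> U \<longrightarrow>
     (\<forall>X\<in>vector_fields \<O> V. \<forall>Y\<in>vector_fields \<O> V. \<forall>Z\<in>vector_fields \<O> V.
        D V X (D V Y Z) - D V Y (D V X Z) - D V (lie \<O> X Y) Z = 0))"

definition torsionless ::
  "('m::topological_space, 'k::real_normed_field) function_sheaf \<Rightarrow> 'm set \<Rightarrow> ('m, 'k) operation \<Rightarrow> bool" where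
  "torsionless \<O> U D \<longleftrightarrow> (\<forall>V. open V \<longrightarrow> V \<subseteq> U \<longrightarrow>
     (\<forall>X\<in>vector_fields \<O> V. \<forall>Y\<in>vector_fields \<O> V. D V X Y - D V Y X - lie \<O> X Y = 0))"

section \<open>Flat and bi-flat F-manifolds\<close>

text \<open>All structures are defined on an open subset \<open>U\<close> of the manifold.\<close>

definition F_manifold ::
  "('m::topological_space, 'k::real_normed_field) function_sheaf \<Rightarrow> 'm set \<Rightarrow>
   ('m, 'k) operation \<Rightarrow> ('m, 'k) vfield \<Rightarrow> bool" where
  "F_manifold \<O> U m e \<longleftrightarrow> bilinear_product \<O> U m \<and> e \<in> vector_fields \<O> U \<and>
     (\<forall>V. open V \<longrightarrow> V \<subseteq> U \<longrightarrow>
        (\<forall>X\<in>vector_fields \<O> V. \<forall>Y\<in>vector_fields \<O> V. \<forall>Z\<in>vector_fields \<O> V. \<forall>W\<in>vector_fields \<O> V.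
           (let times = m V; br = lie \<O> in
              times X Y = times Y X \<and>
              times (times X Y) Z = times X (times Y Z) \<and>
              times (res V e) X = X \<and>
              br (times X Y) (times W Z) - times (br (times X Y) Z) W - times (br (times X Y) W) Z
              - times X (br Y (times Z W)) + times (times X (br Y Z)) W + times (times X (br Y W)) Z
              - times Y (br X (times Z W)) + times (times Y (br X Z)) W + times (times Y (br X W)) Z
              = 0)))"

definition flat_F_manifold ::
  "('m::topological_space, 'k::real_normed_field) function_sheaf \<Rightarrow> 'm set \<Rightarrow>
   ('m, 'k) operation \<Rightarrow> ('m, 'k) operation \<Rightarrow> ('m, 'k) vfield \<Rightarrow> bool" where
  "flat_F_manifold \<O> U D m e \<longleftrightarrow> F_manifold \<O> U m e \<and> connection \<O> U D \<and>
     (\<forall>c. flat \<O> U (\<lambda>V X Y. D V X Y - (\<lambda>_. c) \<odot> m V X Y) \<and>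
          torsionless \<O> U (\<lambda>V X Y. D V X Y - (\<lambda>_. c) \<odot> m V X Y)) \<and>
     (\<forall>V. open V \<longrightarrow> V \<subseteq> U \<longrightarrow> (\<forall>X\<in>vector_fields \<O> V. D V X (res V e) = 0))"

definition Euler_field ::
  "('m::topological_space, 'k::real_normed_field) function_sheaf \<Rightarrow>
   ('m, 'k) operation \<Rightarrow> ('m, 'k) vfield \<Rightarrow> ('m, 'k) vfield \<Rightarrow> bool" where
  "Euler_field \<O> m e E \<longleftrightarrow> E \<in> vector_fields \<O> UNIV \<and> lie \<O> e E = e \<and>
     (\<forall>V. open V \<longrightarrow> (\<forall>X\<in>vector_fields \<O> V. \<forall>Y\<in>vector_fields \<O> V.
        lie \<O> (res V E) (m V X Y) - m V (lie \<O> (res V E) X) Y - m V X (lie \<O> (res V E) Y)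
        = m V X Y))"

text \<open>Invertibility of an endomorphism of the tangent sheaf over an open set, in the sense of sheaves.\<close>

definition invertible_on ::
  "('m::topological_space, 'k::real_normed_field) function_sheaf \<Rightarrow> 'm set \<Rightarrow> ('m, 'k) endo \<Rightarrow> bool" where
  "invertible_on \<O> U F \<longleftrightarrow>
     (\<forall>V. open V \<longrightarrow> V \<subseteq> U \<longrightarrow> bij_betw (F V) (vector_fields \<O> V) (vector_fields \<O> V))"

definition inverse_endo ::
  "('m::topological_space, 'k::real_normed_field) function_sheaf \<Rightarrow> ('m, 'k) endo \<Rightarrow> ('m, 'k) endo" where
  "inverse_endo \<O> F V = inv_into (vector_fields \<O> V) (F V)"

definition invertible_locus ::
  "('m::topological_space, 'k::real_normed_field) function_sheaf \<Rightarrow> 'm set \<Rightarrow> ('m, 'k) endo \<Rightarrow> 'm set" where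
  "invertible_locus \<O> U F = \<Union>{V. open V \<and> V \<subseteq> U \<and> invertible_on \<O> V F}"

definition mult_endo ::
  "('m, 'k::real_normed_field) operation \<Rightarrow> ('m, 'k) vfield \<Rightarrow> ('m, 'k) endo" where
  "mult_endo m E V X = m V (res V E) X"

definition shift_endo :: "('m, 'k::real_normed_field) endo \<Rightarrow> 'k \<Rightarrow> ('m, 'k) endo" where
  "shift_endo L c V X = L V X - (\<lambda>_. c) \<odot> X"

definition bi_flat_F_manifold ::
  "('m::topological_space, 'k::real_normed_field) function_sheaf \<Rightarrow>
   ('m, 'k) operation \<Rightarrow> ('m, 'k) operation \<Rightarrow> ('m, 'k) vfield \<Rightarrow> 'm set \<Rightarrow>
   ('m, 'k) operation \<Rightarrow> ('m, 'k) operation \<Rightarrow> ('m, 'k) vfield \<Rightarrow> bool" where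
  "bi_flat_F_manifold \<O> D m e U D' m' E \<longleftrightarrow>
     flat_F_manifold \<O> UNIV D m e \<and>
     Euler_field \<O> m e E \<and>
     open U \<and> closure U = UNIV \<and> invertible_on \<O> U (mult_endo m E) \<and>
     (\<forall>V. open V \<longrightarrow> V \<subseteq> U \<longrightarrow> (\<forall>X\<in>vector_fields \<O> V. \<forall>Y\<in>vector_fields \<O> V.
        m' V X Y = inverse_endo \<O> (mult_endo m E) V (m V X Y))) \<and>
     flat_F_manifold \<O> U D' m' (res U E) \<and>
     (\<forall>V. open V \<longrightarrow> V \<subseteq> U \<longrightarrow>
        (\<forall>X\<in>vector_fields \<O> V. \<forall>Y\<in>vector_fields \<O> V. \<forall>Z\<in>vector_fields \<O> V.
           D V Y (m V X Z) - D V Z (m V X Y) = D' V Y (m V X Z) - D' V Z (m V X Y)))"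

definition nabla_GM ::
  "('m::topological_space, 'k::real_normed_field) function_sheaf \<Rightarrow> ('m, 'k) endo \<Rightarrow> 'k \<Rightarrow>
   ('m, 'k) operation \<Rightarrow> ('m, 'k) operation \<Rightarrow> ('m, 'k) operation" where
  "nabla_GM \<O> L c D D' V X Y =
     (let X' = inverse_endo \<O> (shift_endo L c) V X
      in D' V X Y + (\<lambda>_. c) \<odot> (D' V X' Y - D V X' Y))"

end

theory Submission
  imports Defs
begin

text \<open>
  Write \<open>L = E\<circ>\<close>, \<open>K X = \<nabla>*\<^sub>X e\<close> and \<open>S X = \<nabla>\<^sub>X E\<close>. The equality of the exterior covariant
  derivatives of \<open>X\<circ>\<close> for both connections, evaluated at \<open>e\<close>, and the parallelism of the units give
  \<open>\<nabla>*\<^sub>X Y = \<nabla>\<^sub>X Y + K (X \<circ> Y)\<close> and \<open>K L = - S\<close>. Hence the connection \<open>\<nabla>GM\<close> differs from \<open>\<nabla>*\<close> by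
  \<open>\<lambda> K (L\<^sub>\<lambda>\<^sup>-\<^sup>1 X \<circ> Y)\<close>, which is symmetric in \<open>X\<close> and \<open>Y\<close>, and so it is torsionless.

  For the flatness one replaces \<open>X\<close> by \<open>L\<^sub>\<lambda> X\<close>: then \<open>\<nabla>GM\<close> becomes \<open>P\<^sub>X = \<nabla>*\<^bsub>LX\<^esub> - \<lambda> \<nabla>\<^sub>X\<close>, a linear pencil.
  The Nijenhuis torsion of \<open>L\<close> vanishes (\<open>Nijenhuis\<close>), so \<open>[L\<^sub>\<lambda> X, L\<^sub>\<lambda> Y] = L\<^sub>\<lambda> ([X, Y]\<^sub>L - \<lambda> [X, Y])\<close>, and
  the curvature of \<open>\<nabla>GM\<close> at \<open>L\<^sub>\<lambda> X\<close> and \<open>L\<^sub>\<lambda> Y\<close> is a polynomial of degree 2 in \<open>\<lambda>\<close>. Its extreme coefficients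
  are curvatures of \<open>\<nabla>*\<close> and \<open>\<nabla>\<close>. Its middle coefficient vanishes if and only if
  \<open>H (X, Y \<circ> Z) = H (Y, X \<circ> Z)\<close> for the second covariant derivative \<open>H (X, W) = (\<nabla>\<^sub>X S) W\<close> of \<open>E\<close>.

  That this holds is the heart of the proof (\<open>D_S\<close>): \<open>H (X, W)\<close> depends only on \<open>X \<circ> W\<close>. One differentiates
  \<open>S = - K L\<close>. The derivative of \<open>L\<close> is known from the Euler condition (\<open>D_E_m\<close>); the derivative of \<open>K\<close> in any
  direction is reduced to that in direction \<open>e\<close> by the flatness of \<open>\<nabla>*\<close> (\<open>D_K\<close>); and the terms that depend on
  \<open>X\<close> and \<open>W\<close> separately cancel.

  The remaining work is sheaf theory. The functions of either regularity class form a sheaf of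
  algebras, so vector fields form a sheaf of modules, closed under all operations that occur; and \<open>L\<^sub>\<lambda>\<close>,
  which is invertible on each member of a cover of its invertible locus, is invertible on the whole locus
  because local preimages glue.
\<close>

section \<open>Functions with continuous partial derivatives\<close>

lemma axis_zero [simp]: "axis i 0 = 0" by (simp add: axis_def vec_eq_iff)

lemma continuous_on_axis: "continuous_on UNIV (\<lambda>t. x + axis i (t::'k::real_normed_field) :: 'k ^ 'n::finite)"
  unfolding axis_def
proof (intro continuous_intros)
  fix j show "continuous_on UNIV (\<lambda>t. if j = i then t else (0::'k))" by (cases "j = i") simp_all
qed

lemma eventually_axis:
  fixes x :: "'k::real_normed_field ^ 'n::finite"
  assumes "open V" "x \<in> V"
  shows "\<forall>\<^sub>F t in nhds 0. x + axis i t \<in> V"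
proof -
  have "isCont (\<lambda>t. x + axis i t) 0"
    using continuous_on_axis[of x i] by (simp add: continuous_on_eq_continuous_at)
  moreover have "x + axis i 0 \<in> V" using assms by simp
  ultimately show ?thesis
    using assms(1) unfolding continuous_at_open eventually_nhds by blast
qed

lemma partial_deriv_cong:
  assumes "open V" "\<And>x. x \<in> V \<Longrightarrow> f x = g x" "x \<in> V"
  shows "partial_deriv i f x = partial_deriv i g x"
  unfolding partial_deriv_def
  by (intro deriv_cong_ev refl eventually_mono[OF eventually_axis[OF assms(1,3)]] assms(2))

lemma field_differentiable_cong:
  assumes "\<forall>\<^sub>F t in nhds a. f t = g t" "f field_differentiable (at a)"
  shows "g field_differentiable (at a)"
  using assms(2) DERIV_cong_ev[OF refl assms(1) refl] unfolding field_differentiable_def by metis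

lemma Ck_on_cong:
  assumes "open V" "\<And>x. x \<in> V \<Longrightarrow> f x = g x" "Ck_on r V f"
  shows "Ck_on r V g"
  using assms(2,3)
proof (induction r arbitrary: f g)
  case 0
  then show ?case using continuous_on_cong[of V V f g] by simp
next
  case (Suc r)
  have "continuous_on V g" using Suc.prems continuous_on_cong[of V V f g] by simp
  moreover have "(\<lambda>t. g (x + axis i t)) field_differentiable (at 0)" if "x \<in> V" for i x
  proof (rule field_differentiable_cong[of "\<lambda>t. f (x + axis i t)"])
    show "\<forall>\<^sub>F t in nhds 0. f (x + axis i t) = g (x + axis i t)"
      by (rule eventually_mono[OF eventually_axis[OF assms(1) that]]) (rule Suc.prems(1))
  qed (use that Suc.prems in simp)
  moreover have "Ck_on r V (partial_deriv i g)" for i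
  proof (rule Suc.IH)
    show "partial_deriv i f x = partial_deriv i g x" if "x \<in> V" for x
      by (rule partial_deriv_cong[OF assms(1) Suc.prems(1) that])
  qed (use Suc.prems in simp)
  ultimately show ?case by simp
qed

lemma Ck_on_subset: "Ck_on r V f \<Longrightarrow> W \<subseteq> V \<Longrightarrow> Ck_on r W f"
proof (induction r arbitrary: f)
  case 0
  then show ?case using continuous_on_subset[of V f W] by simp
next
  case (Suc r)
  then show ?case using continuous_on_subset[of V f W] by (simp add: subset_iff)
qed

text \<open>
  Differentiability is a pointwise condition and continuity on a union of open sets is tested on the
  members, so the class is local; this is what allows sections of the structure sheaf to be glued.
\<close>

lemma Ck_on_Union:
  assumes "\<And>V. V \<in> \<V> \<Longrightarrow> open V" "\<And>V. V \<in> \<V> \<Longrightarrow> Ck_on r V f"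
  shows "Ck_on r (\<Union>\<V>) f"
  using assms(2)
proof (induction r arbitrary: f)
  case 0
  then show ?case using continuous_on_open_Union[of \<V> f] assms(1) by simp
next
  case (Suc r)
  have "continuous_on (\<Union>\<V>) f"
    using continuous_on_open_Union[of \<V> f] assms(1) Suc.prems by simp
  moreover have "Ck_on r (\<Union>\<V>) (partial_deriv i f)" for i
    by (rule Suc.IH) (use Suc.prems in simp)
  moreover have "(\<lambda>t. f (x + axis i t)) field_differentiable (at 0)" if "x \<in> \<Union>\<V>" for i x
    using that Suc.prems by force
  ultimately show ?case by simp
qed

text \<open>
  In the Leibniz rule the undifferentiated factors must be fed to the induction hypothesis of one
  order less, which is where this inclusion is needed.
\<close>

lemma Ck_on_SucD: "Ck_on (Suc r) V f \<Longrightarrow> Ck_on r V f"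
proof (induction r arbitrary: f)
  case (Suc r)
  then show ?case by (simp (no_asm_use)) (simp add: Suc.IH)
qed simp

lemma Ck_on_const:
  fixes V :: "('k::real_normed_field ^ 'n::finite) set"
  shows "Ck_on r V (\<lambda>_. c)"
proof (induction r arbitrary: c)
  case (Suc r)
  have "partial_deriv i (\<lambda>_ :: 'k ^ 'n. c) = (\<lambda>_. 0)" for i
    by (auto simp: partial_deriv_def fun_eq_iff)
  then show ?case using Suc by simp
qed simp

lemma Ck_on_add:
  assumes "open V" "Ck_on r V f" "Ck_on r V g"
  shows "Ck_on r V (\<lambda>x. f x + g x)"
  using assms(2,3)
proof (induction r arbitrary: f g)
  case 0
  then show ?case by (simp add: continuous_on_add)
next
  case (Suc r)
  have diff: "(\<lambda>t. f (x + axis i t)) field_differentiable (at 0)"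
       "(\<lambda>t. g (x + axis i t)) field_differentiable (at 0)" if "x \<in> V" for x i
    using Suc.prems that by simp_all
  have "Ck_on r V (partial_deriv i (\<lambda>x. f x + g x))" for i
  proof (rule Ck_on_cong[OF assms(1)])
    show "Ck_on r V (\<lambda>x. partial_deriv i f x + partial_deriv i g x)"
      by (rule Suc.IH) (use Suc.prems in simp_all)
  qed (simp add: partial_deriv_def diff)
  moreover have "(\<lambda>t. f (x + axis i t) + g (x + axis i t)) field_differentiable (at 0)"
    if "x \<in> V" for x i
    by (rule field_differentiable_add) (rule diff[OF that])+
  moreover have "continuous_on V (\<lambda>x. f x + g x)"
    using Suc.prems by (simp add: continuous_on_add)
  ultimately show ?case by simp
qed

lemma Ck_on_mult:
  assumes "open V" "Ck_on r V f" "Ck_on r V g"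
  shows "Ck_on r V (\<lambda>x. f x * g x)"
  using assms(2,3)
proof (induction r arbitrary: f g)
  case 0
  then show ?case by (simp add: continuous_on_mult)
next
  case (Suc r)
  have diff: "(\<lambda>t. f (x + axis i t)) field_differentiable (at 0)"
       "(\<lambda>t. g (x + axis i t)) field_differentiable (at 0)" if "x \<in> V" for x i
    using Suc.prems that by simp_all
  have "Ck_on r V (partial_deriv i (\<lambda>x. f x * g x))" for i
  proof (rule Ck_on_cong[OF assms(1)])
    show "Ck_on r V (\<lambda>x. f x * partial_deriv i g x + partial_deriv i f x * g x)"
      by (intro Ck_on_add[OF assms(1)] Suc.IH)
         (use Suc.prems Ck_on_SucD[of r V f] Ck_on_SucD[of r V g] in simp_all)
  qed (simp add: partial_deriv_def diff)
  moreover have "(\<lambda>t. f (x + axis i t) * g (x + axis i t)) field_differentiable (at 0)"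
    if "x \<in> V" for x i
    by (rule field_differentiable_mult) (rule diff[OF that])+
  moreover have "continuous_on V (\<lambda>x. f x * g x)"
    using Suc.prems by (simp add: continuous_on_mult)
  ultimately show ?case by simp
qed

section \<open>Functions given by power series\<close>

lemma abs_summable_on_times:
  fixes f :: "'a \<Rightarrow> 'c::real_normed_algebra" and g :: "'b \<Rightarrow> 'c"
  assumes "f abs_summable_on A" "g abs_summable_on B"
  shows "(\<lambda>(x, y). f x * g y) abs_summable_on A \<times> B"
proof -
  have "(\<lambda>(x, y). norm (f x) * norm (g y)) summable_on Sigma A (\<lambda>_. B)"
  proof (rule summable_on_SigmaI)
    show "((\<lambda>y. case (x, y) of (x, y) \<Rightarrow> norm (f x) * norm (g y)) has_sum
        (norm (f x) * infsum (\<lambda>y. norm (g y)) B)) B" for x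
      using has_sum_cmult_right[OF has_sum_infsum[OF assms(2)], of "norm (f x)"] by simp
    show "(\<lambda>x. norm (f x) * infsum (\<lambda>y. norm (g y)) B) summable_on A"
      by (rule summable_on_cmult_left[OF assms(1)])
  qed auto
  then show ?thesis
    by (rule summable_on_comparison_test) (auto simp: norm_mult_ineq)
qed

lemma eventually_finite_subsets_at_topE:
  assumes "eventually P (finite_subsets_at_top A)"
  obtains X where "finite X" "X \<subseteq> A" "\<And>Y. finite Y \<Longrightarrow> X \<subseteq> Y \<Longrightarrow> Y \<subseteq> A \<Longrightarrow> P Y"
  using assms unfolding eventually_finite_subsets_at_top by metis

text \<open>
  The ring need not be complete, because the limit is known in advance: it is attained along the
  rectangles \<open>X \<times> Y\<close>, and the absolute convergence of the product family makes the remainder outside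
  a large rectangle small.
\<close>

lemma has_sum_times:
  fixes f :: "'a \<Rightarrow> 'c::real_normed_algebra" and g :: "'b \<Rightarrow> 'c"
  assumes f: "f abs_summable_on A" "(f has_sum a) A" and g: "g abs_summable_on B" "(g has_sum b) B"
  shows "((\<lambda>(x, y). f x * g y) has_sum (a * b)) (A \<times> B)"
  unfolding has_sum_def
proof (rule tendstoI)
  fix \<epsilon> :: real assume "\<epsilon> > 0"
  define h where "h = (\<lambda>(x, y). f x * g y)"
  have h: "h abs_summable_on A \<times> B"
    unfolding h_def by (rule abs_summable_on_times[OF f(1) g(1)])
  define N where "N = infsum (\<lambda>p. norm (h p)) (A \<times> B)"
  have N: "((\<lambda>p. norm (h p)) has_sum N) (A \<times> B)"
    unfolding N_def using h by (rule has_sum_infsum)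
  \<comment> \<open>Beyond \<open>F0\<close> the absolute series has less than \<open>\<epsilon> / 2\<close> left; the rectangle is then chosen to
    contain \<open>F0\<close> and to have a product of partial sums within \<open>\<epsilon> / 2\<close> of \<open>a * b\<close>.\<close>
  have N_ge: "sum (\<lambda>p. norm (h p)) F \<le> N" if "finite F" "F \<subseteq> A \<times> B" for F
    unfolding N_def by (rule finite_sum_le_infsum[OF h that]) simp
  have "\<forall>\<^sub>F F in finite_subsets_at_top (A \<times> B). dist (sum (\<lambda>p. norm (h p)) F) N < \<epsilon> / 2"
    by (rule tendstoD[OF N[unfolded has_sum_def]]) (use \<open>\<epsilon> > 0\<close> in simp)
  then obtain F0 where F0: "finite F0" "F0 \<subseteq> A \<times> B"
    and tail: "\<And>F. finite F \<Longrightarrow> F0 \<subseteq> F \<Longrightarrow> F \<subseteq> A \<times> B \<Longrightarrow> dist (sum (\<lambda>p. norm (h p)) F) N < \<epsilon> / 2"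
    by (rule eventually_finite_subsets_at_topE) (rule that)
  have "((\<lambda>(X, Y). sum f X * sum g Y) \<longlongrightarrow> a * b)
     (finite_subsets_at_top A \<times>\<^sub>F finite_subsets_at_top B)"
    unfolding case_prod_unfold
    by (intro tendsto_mult filterlim_compose[OF f(2)[unfolded has_sum_def] filterlim_fst]
          filterlim_compose[OF g(2)[unfolded has_sum_def] filterlim_snd])
  then have "\<forall>\<^sub>F (X, Y) in finite_subsets_at_top A \<times>\<^sub>F finite_subsets_at_top B.
      dist (sum f X * sum g Y) (a * b) < \<epsilon> / 2"
    unfolding case_prod_unfold by (rule tendstoD) (use \<open>\<epsilon> > 0\<close> in simp)
  then obtain P Q where PQ: "eventually P (finite_subsets_at_top A)" "eventually Q (finite_subsets_at_top B)"
    "\<And>X Y. P X \<Longrightarrow> Q Y \<Longrightarrow> dist (sum f X * sum g Y) (a * b) < \<epsilon> / 2"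
    unfolding eventually_prod_filter by auto
  obtain X0 where X0: "finite X0" "X0 \<subseteq> A" "\<And>X. finite X \<Longrightarrow> X0 \<subseteq> X \<Longrightarrow> X \<subseteq> A \<Longrightarrow> P X"
    using PQ(1) by (rule eventually_finite_subsets_at_topE) (rule that)
  obtain Y0 where Y0: "finite Y0" "Y0 \<subseteq> B" "\<And>Y. finite Y \<Longrightarrow> Y0 \<subseteq> Y \<Longrightarrow> Y \<subseteq> B \<Longrightarrow> Q Y"
    using PQ(2) by (rule eventually_finite_subsets_at_topE) (rule that)
  define X Y where "X = X0 \<union> fst ` F0" and "Y = Y0 \<union> snd ` F0"
  have R: "finite (X \<times> Y)" "F0 \<subseteq> X \<times> Y" "X \<times> Y \<subseteq> A \<times> B"
    using X0(1,2) Y0(1,2) F0 subset_fst_snd[of F0] by (auto simp: X_def Y_def)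
  have "P X" "Q Y"
    using X0(1,2) Y0(1,2) F0 by (auto simp: X_def Y_def intro!: X0(3) Y0(3))
  then have "dist (sum f X * sum g Y) (a * b) < \<epsilon> / 2" by (rule PQ(3))
  moreover have "sum h (X \<times> Y) = sum f X * sum g Y"
    unfolding h_def sum_product sum.cartesian_product by simp
  ultimately have rect: "dist (sum h (X \<times> Y)) (a * b) < \<epsilon> / 2" by simp
  have "dist (sum h F) (a * b) < \<epsilon>" if F: "finite F" "X \<times> Y \<subseteq> F" "F \<subseteq> A \<times> B" for F
  proof -
    have "sum h F - sum h (X \<times> Y) = sum h (F - X \<times> Y)"
      using F by (simp add: sum_diff)
    then have "dist (sum h F) (sum h (X \<times> Y)) \<le> sum (\<lambda>p. norm (h p)) (F - X \<times> Y)"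
      by (simp add: dist_norm norm_sum)
    also have "\<dots> = sum (\<lambda>p. norm (h p)) F - sum (\<lambda>p. norm (h p)) (X \<times> Y)"
      using F by (simp add: sum_diff)
    also have "\<dots> < \<epsilon> / 2"
      using N_ge[OF F(1,3)] tail[OF R] unfolding dist_real_def by linarith
    finally show ?thesis
      using rect dist_triangle[of "sum h F" "a * b" "sum h (X \<times> Y)"] by simp
  qed
  then show "\<forall>\<^sub>F F in finite_subsets_at_top (A \<times> B). dist (sum (\<lambda>(x, y). f x * g y) F) (a * b) < \<epsilon>"
    unfolding eventually_finite_subsets_at_top h_def[symmetric] using R(1,3) by blast
qed

lemma finite_multi_indices_below: "finite {\<alpha>. \<forall>i. \<alpha> i \<le> (\<gamma> :: 'n::finite \<Rightarrow> nat) i}"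
proof -
  have "{\<alpha>. \<forall>i. \<alpha> i \<le> \<gamma> i} = (\<Pi>\<^sub>E i\<in>UNIV. {..\<gamma> i})"
    by (auto simp: PiE_def Pi_def)
  then show ?thesis by (simp add: finite_PiE)
qed

definition cauchy_product ::
  "(('n::finite \<Rightarrow> nat) \<Rightarrow> 'k::real_normed_field) \<Rightarrow> (('n \<Rightarrow> nat) \<Rightarrow> 'k) \<Rightarrow> ('n \<Rightarrow> nat) \<Rightarrow> 'k" where
  "cauchy_product c d \<gamma> = (\<Sum>\<alpha> | \<forall>i. \<alpha> i \<le> \<gamma> i. c \<alpha> * d (\<lambda>i. \<gamma> i - \<alpha> i))"

lemma power_series_term_cauchy_product:
  "power_series_term (cauchy_product c d) z \<gamma> =
     (\<Sum>\<alpha> | \<forall>i. \<alpha> i \<le> \<gamma> i. power_series_term c z \<alpha> * power_series_term d z (\<lambda>i. \<gamma> i - \<alpha> i))"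
  unfolding power_series_term_def cauchy_product_def sum_distrib_right
proof (rule sum.cong[OF refl])
  fix \<alpha> assume "\<alpha> \<in> {\<alpha>. \<forall>i. \<alpha> i \<le> \<gamma> i}"
  then have "(\<Prod>i\<in>UNIV. z $ i ^ \<gamma> i) = (\<Prod>i\<in>UNIV. z $ i ^ \<alpha> i) * (\<Prod>i\<in>UNIV. z $ i ^ (\<gamma> i - \<alpha> i))"
    by (simp add: prod.distrib[symmetric] power_add[symmetric])
  then show "c \<alpha> * d (\<lambda>i. \<gamma> i - \<alpha> i) * (\<Prod>i\<in>UNIV. z $ i ^ \<gamma> i) =
      c \<alpha> * (\<Prod>i\<in>UNIV. z $ i ^ \<alpha> i) * (d (\<lambda>i. \<gamma> i - \<alpha> i) * (\<Prod>i\<in>UNIV. z $ i ^ (\<gamma> i - \<alpha> i)))"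
    by (simp add: mult_ac)
qed

text \<open>
  The pairs \<open>(\<alpha>, \<beta>)\<close> correspond to the pairs of a total index \<open>\<gamma> = \<alpha> + \<beta>\<close> and an
  \<open>\<alpha> \<le> \<gamma>\<close>. For each \<open>\<gamma>\<close> there are finitely many \<open>\<alpha>\<close>, so the inner sums exist in any
  topological monoid. That generality covers both the terms of a power series and their norms.
\<close>

lemma has_sum_regroup_multi_indices:
  fixes h :: "('n::finite \<Rightarrow> nat) \<Rightarrow> ('n \<Rightarrow> nat) \<Rightarrow> 'c::{topological_comm_monoid_add,t3_space}"
  assumes "((\<lambda>(\<alpha>, \<beta>). h \<alpha> \<beta>) has_sum s) (UNIV \<times> UNIV)"
  shows "((\<lambda>\<gamma>. \<Sum>\<alpha> | \<forall>i. \<alpha> i \<le> \<gamma> i. h \<alpha> (\<lambda>i. \<gamma> i - \<alpha> i)) has_sum s) UNIV"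
proof (rule has_sum_SigmaD)
  show "((\<lambda>(\<gamma>, \<alpha>). h \<alpha> (\<lambda>i. \<gamma> i - \<alpha> i)) has_sum s) (SIGMA \<gamma>:UNIV. {\<alpha>. \<forall>i. \<alpha> i \<le> \<gamma> i})"
    using assms
    by (subst has_sum_reindex_bij_witness[where
          j = "\<lambda>(\<gamma>, \<alpha>). (\<alpha>, \<lambda>i. \<gamma> i - \<alpha> i)" and i = "\<lambda>(\<alpha>, \<beta>). (\<lambda>i. \<alpha> i + \<beta> i, \<alpha>)"
          and h = "\<lambda>(\<alpha>, \<beta>). h \<alpha> \<beta>" and T = "UNIV \<times> UNIV"]) auto
qed (simp add: finite_multi_indices_below)

lemma analytic_at_point_mult:
  assumes "analytic_at_point f a" "analytic_at_point g a"
  shows "analytic_at_point (\<lambda>x. f x * g x) a"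
proof -
  obtain c \<delta> where c: "\<delta> > 0" "\<And>x. x \<in> ball a \<delta> \<Longrightarrow> power_series_term c (x - a) abs_summable_on UNIV"
    "\<And>x. x \<in> ball a \<delta> \<Longrightarrow> (power_series_term c (x - a) has_sum f x) UNIV"
    using assms(1) unfolding analytic_at_point_def by blast
  obtain d \<epsilon> where d: "\<epsilon> > 0" "\<And>x. x \<in> ball a \<epsilon> \<Longrightarrow> power_series_term d (x - a) abs_summable_on UNIV"
    "\<And>x. x \<in> ball a \<epsilon> \<Longrightarrow> (power_series_term d (x - a) has_sum g x) UNIV"
    using assms(2) unfolding analytic_at_point_def by blast
  have "power_series_term (cauchy_product c d) (x - a) abs_summable_on UNIV \<and>
      (power_series_term (cauchy_product c d) (x - a) has_sum (f x * g x)) UNIV"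
    if "x \<in> ball a (min \<delta> \<epsilon>)" for x
  proof -
    let ?h = "\<lambda>\<alpha> \<beta>. power_series_term c (x - a) \<alpha> * power_series_term d (x - a) \<beta>"
    have x: "x \<in> ball a \<delta>" "x \<in> ball a \<epsilon>" using that by auto
    have "(power_series_term (cauchy_product c d) (x - a) has_sum (f x * g x)) UNIV"
      unfolding power_series_term_cauchy_product[abs_def]
      by (intro has_sum_regroup_multi_indices has_sum_times c d x)
    moreover have "(\<lambda>(\<alpha>, \<beta>). norm (?h \<alpha> \<beta>)) summable_on UNIV \<times> UNIV"
      using abs_summable_on_times[OF c(2)[OF x(1)] d(2)[OF x(2)]] by (simp add: case_prod_unfold)
    then obtain s where "((\<lambda>(\<alpha>, \<beta>). norm (?h \<alpha> \<beta>)) has_sum s) (UNIV \<times> UNIV)"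
      unfolding summable_on_def by blast
    from has_sum_regroup_multi_indices[OF this]
    have "(\<lambda>\<gamma>. \<Sum>\<alpha> | \<forall>i. \<alpha> i \<le> \<gamma> i. norm (?h \<alpha> (\<lambda>i. \<gamma> i - \<alpha> i))) summable_on UNIV"
      unfolding summable_on_def by blast
    then have "power_series_term (cauchy_product c d) (x - a) abs_summable_on UNIV"
      by (rule summable_on_comparison_test)
         (auto simp: power_series_term_cauchy_product intro: norm_sum)
    ultimately show ?thesis by blast
  qed
  then show ?thesis
    unfolding analytic_at_point_def using c(1) d(1)
    by (intro exI[of _ "cauchy_product c d"] exI[of _ "min \<delta> \<epsilon>"]) simp
qed

lemma analytic_at_point_add:
  assumes "analytic_at_point f a" "analytic_at_point g a"
  shows "analytic_at_point (\<lambda>x. f x + g x) a"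
proof -
  obtain c \<delta> where c: "\<delta> > 0" "\<And>x. x \<in> ball a \<delta> \<Longrightarrow> power_series_term c (x - a) abs_summable_on UNIV"
    "\<And>x. x \<in> ball a \<delta> \<Longrightarrow> (power_series_term c (x - a) has_sum f x) UNIV"
    using assms(1) unfolding analytic_at_point_def by blast
  obtain d \<epsilon> where d: "\<epsilon> > 0" "\<And>x. x \<in> ball a \<epsilon> \<Longrightarrow> power_series_term d (x - a) abs_summable_on UNIV"
    "\<And>x. x \<in> ball a \<epsilon> \<Longrightarrow> (power_series_term d (x - a) has_sum g x) UNIV"
    using assms(2) unfolding analytic_at_point_def by blast
  have split: "power_series_term (\<lambda>\<alpha>. c \<alpha> + d \<alpha>) z = (\<lambda>\<alpha>. power_series_term c z \<alpha> + power_series_term d z \<alpha>)" for z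
    by (simp add: power_series_term_def fun_eq_iff distrib_right)
  have "power_series_term (\<lambda>\<alpha>. c \<alpha> + d \<alpha>) (x - a) abs_summable_on UNIV \<and>
      (power_series_term (\<lambda>\<alpha>. c \<alpha> + d \<alpha>) (x - a) has_sum (f x + g x)) UNIV"
    if "x \<in> ball a (min \<delta> \<epsilon>)" for x
  proof
    have x: "x \<in> ball a \<delta>" "x \<in> ball a \<epsilon>" using that by auto
    show "(power_series_term (\<lambda>\<alpha>. c \<alpha> + d \<alpha>) (x - a) has_sum (f x + g x)) UNIV"
      unfolding split by (intro has_sum_add c d x)
    show "power_series_term (\<lambda>\<alpha>. c \<alpha> + d \<alpha>) (x - a) abs_summable_on UNIV"
      unfolding split by (rule summable_on_comparison_test[OF summable_on_add[OF c(2)[OF x(1)] d(2)[OF x(2)]]])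
        (auto simp: norm_triangle_ineq)
  qed
  then show ?thesis
    unfolding analytic_at_point_def using c(1) d(1)
    by (intro exI[of _ "\<lambda>\<alpha>. c \<alpha> + d \<alpha>"] exI[of _ "min \<delta> \<epsilon>"]) simp
qed

lemma analytic_at_point_const: "analytic_at_point (\<lambda>_. k) a"
proof -
  define c :: "('b \<Rightarrow> nat) \<Rightarrow> 'a" where "c \<alpha> = (if \<alpha> = (\<lambda>_. 0) then k else 0)" for \<alpha>
  have term_eq: "power_series_term c z = c" for z
    by (auto simp: power_series_term_def c_def fun_eq_iff)
  have "(c has_sum k) UNIV"
    by (subst has_sum_cong_neutral[of "{\<lambda>_. 0}" _ c]) (auto simp: c_def intro: has_sum_finiteI)
  moreover have "c abs_summable_on UNIV"
    by (subst summable_on_cong_neutral[of "{\<lambda>_. 0}" _ "\<lambda>\<alpha>. norm (c \<alpha>)"]) (auto simp: c_def)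
  ultimately show ?thesis
    unfolding analytic_at_point_def by (intro exI[of _ c] exI[of _ 1]) (simp add: term_eq)
qed

text \<open>
  The disc of convergence may be shrunk to lie in \<open>V\<close>, so only the germ matters.
\<close>

lemma analytic_at_point_cong:
  assumes "open V" "a \<in> V" "\<And>x. x \<in> V \<Longrightarrow> f x = g x" "analytic_at_point f a"
  shows "analytic_at_point g a"
proof -
  obtain c \<delta> where c: "\<delta> > 0" "\<forall>x\<in>ball a \<delta>. (\<lambda>\<alpha>. norm (power_series_term c (x - a) \<alpha>)) summable_on UNIV \<and>
     (power_series_term c (x - a) has_sum f x) UNIV"
    using assms(4) unfolding analytic_at_point_def by blast
  obtain \<epsilon> where "\<epsilon> > 0" "ball a \<epsilon> \<subseteq> V"
    using assms(1,2) open_contains_ball by blast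
  then have "x \<in> ball a \<delta> \<and> f x = g x" if "x \<in> ball a (min \<delta> \<epsilon>)" for x
    using that assms(3) by auto
  then show ?thesis
    unfolding analytic_at_point_def using c \<open>\<epsilon> > 0\<close>
    by (intro exI[of _ c] exI[of _ "min \<delta> \<epsilon>"]) (metis min_less_iff_conj)
qed

section \<open>The structure sheaf\<close>

lemma regular_on_subset: "regular_on reg V f \<Longrightarrow> W \<subseteq> V \<Longrightarrow> regular_on reg W f"
  using Ck_on_subset[of _ V f W] by (cases reg) (simp_all add: subset_iff)

lemma regular_on_cong:
  assumes "open V" "\<And>x. x \<in> V \<Longrightarrow> f x = g x" "regular_on reg V f"
  shows "regular_on reg V g"
proof (cases reg)
  case Smooth
  then show ?thesis using assms(3) Ck_on_cong[OF assms(1,2)] by simp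
next
  case Analytic
  then show ?thesis using assms(3) analytic_at_point_cong[OF assms(1) _ assms(2)] by simp
qed

lemma regular_on_Union:
  assumes "\<And>V. V \<in> \<V> \<Longrightarrow> open V" "\<And>V. V \<in> \<V> \<Longrightarrow> regular_on reg V f"
  shows "regular_on reg (\<Union>\<V>) f"
proof (cases reg)
  case Smooth
  then show ?thesis using assms(2) Ck_on_Union[OF assms(1)] by simp
next
  case Analytic
  then show ?thesis using assms(2) by auto
qed

lemma regular_on_const: "regular_on reg V (\<lambda>_. c)"
  by (cases reg) (simp_all add: Ck_on_const analytic_at_point_const)

lemma regular_on_add:
  "open V \<Longrightarrow> regular_on reg V f \<Longrightarrow> regular_on reg V g \<Longrightarrow> regular_on reg V (\<lambda>x. f x + g x)"
  by (cases reg) (simp_all add: Ck_on_add analytic_at_point_add)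

lemma regular_on_mult:
  "open V \<Longrightarrow> regular_on reg V f \<Longrightarrow> regular_on reg V g \<Longrightarrow> regular_on reg V (\<lambda>x. f x * g x)"
  by (cases reg) (simp_all add: Ck_on_mult analytic_at_point_mult)

text \<open>
  The properties of the structure sheaf through which the regularity class enters: functions over
  \<open>V\<close> form an algebra, depend only on their values on \<open>V\<close>, restrict and glue.
\<close>

locale sheaf_of_algebras =
  fixes \<O> :: "('m::topological_space, 'k::real_normed_field) function_sheaf"
  assumes sections_restrict: "f \<in> \<O> V \<Longrightarrow> W \<subseteq> V \<Longrightarrow> f \<in> \<O> W"
    and sections_cong: "open V \<Longrightarrow> f \<in> \<O> V \<Longrightarrow> (\<And>p. p \<in> V \<Longrightarrow> f p = g p) \<Longrightarrow> g \<in> \<O> V"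
    and sections_glue: "(\<And>V. V \<in> \<V> \<Longrightarrow> open V) \<Longrightarrow> (\<And>V. V \<in> \<V> \<Longrightarrow> f \<in> \<O> V) \<Longrightarrow> f \<in> \<O> (\<Union>\<V>)"
    and sections_const: "(\<lambda>_. c) \<in> \<O> V"
    and sections_add: "open V \<Longrightarrow> f \<in> \<O> V \<Longrightarrow> g \<in> \<O> V \<Longrightarrow> (\<lambda>p. f p + g p) \<in> \<O> V"
    and sections_mult: "open V \<Longrightarrow> f \<in> \<O> V \<Longrightarrow> g \<in> \<O> V \<Longrightarrow> (\<lambda>p. f p * g p) \<in> \<O> V"

lemma open_chart_image:
  assumes "manifold reg \<A>" "(d, \<phi>) \<in> \<A>" "open V"
  shows "open (\<phi> ` (d \<inter> V))"
proof -
  obtain \<psi> where "open (\<phi> ` d)" and hom: "homeomorphism d (\<phi> ` d) \<phi> \<psi>"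
    using assms(1,2) unfolding manifold_def by fast
  then show ?thesis
    using homeomorphism_imp_open_map[OF hom, of "d \<inter> V"] assms(3)
    by (meson openin_open_Int openin_open_trans)
qed

lemma inj_on_chart:
  assumes "manifold reg \<A>" "(d, \<phi>) \<in> \<A>"
  shows "inj_on \<phi> d"
proof -
  obtain \<psi> where "homeomorphism d (\<phi> ` d) \<phi> \<psi>"
    using assms unfolding manifold_def by fast
  then show ?thesis by (metis homeomorphism_apply1 inj_on_inverseI)
qed

text \<open>
  The sets \<open>\<phi> ` (d \<inter> V)\<close> on which regularity is tested are open in the model space, so that it is a
  local condition there, and by injectivity of \<open>\<phi>\<close> it involves only the values on \<open>V\<close>.
\<close>

lemma sheaf_of_algebras_structure_sheaf:
  assumes M: "manifold reg \<A>"
  shows "sheaf_of_algebras (structure_sheaf reg \<A>)"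
proof
  fix f g :: "'a \<Rightarrow> 'b" and c :: 'b and V W :: "'a set" and \<V> :: "'a set set"
  note op = open_chart_image[OF M]
  show "f \<in> structure_sheaf reg \<A> W" if "f \<in> structure_sheaf reg \<A> V" "W \<subseteq> V"
    unfolding structure_sheaf_def
  proof safe
    fix d \<phi> assume "(d, \<phi>) \<in> \<A>"
    then have "regular_on reg (\<phi> ` (d \<inter> V)) (\<lambda>x. f (inv_into d \<phi> x))"
      using that(1) by (auto simp: structure_sheaf_def)
    then show "regular_on reg (\<phi> ` (d \<inter> W)) (\<lambda>x. f (inv_into d \<phi> x))"
      by (rule regular_on_subset) (use that(2) in blast)
  qed
  show "g \<in> structure_sheaf reg \<A> V"
    if V: "open V" and f: "f \<in> structure_sheaf reg \<A> V" and eq: "\<And>p. p \<in> V \<Longrightarrow> f p = g p"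
    unfolding structure_sheaf_def
  proof safe
    fix d \<phi> assume d: "(d, \<phi>) \<in> \<A>"
    show "regular_on reg (\<phi> ` (d \<inter> V)) (\<lambda>x. g (inv_into d \<phi> x))"
    proof (rule regular_on_cong[OF op[OF d V]])
      show "f (inv_into d \<phi> x) = g (inv_into d \<phi> x)" if x: "x \<in> \<phi> ` (d \<inter> V)" for x
      proof -
        obtain p where "p \<in> d" "p \<in> V" "x = \<phi> p" using x by blast
        then show ?thesis using eq inv_into_f_f[OF inj_on_chart[OF M d], of p] by simp
      qed
      show "regular_on reg (\<phi> ` (d \<inter> V)) (\<lambda>x. f (inv_into d \<phi> x))"
        using f d by (auto simp: structure_sheaf_def)
    qed
  qed
  show "f \<in> structure_sheaf reg \<A> (\<Union>\<V>)"
    if V: "\<And>V. V \<in> \<V> \<Longrightarrow> open V" and f: "\<And>V. V \<in> \<V> \<Longrightarrow> f \<in> structure_sheaf reg \<A> V"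
    unfolding structure_sheaf_def
  proof safe
    fix d \<phi> assume d: "(d, \<phi>) \<in> \<A>"
    have "regular_on reg (\<Union>((\<lambda>V. \<phi> ` (d \<inter> V)) ` \<V>)) (\<lambda>x. f (inv_into d \<phi> x))"
    proof (rule regular_on_Union)
      fix T assume "T \<in> (\<lambda>V. \<phi> ` (d \<inter> V)) ` \<V>"
      then obtain V where T: "V \<in> \<V>" "T = \<phi> ` (d \<inter> V)" by blast
      show "open T" using op[OF d V[OF T(1)]] T(2) by simp
      show "regular_on reg T (\<lambda>x. f (inv_into d \<phi> x))"
        using f[OF T(1)] d T(2) by (auto simp: structure_sheaf_def)
    qed
    moreover have "\<phi> ` (d \<inter> \<Union>\<V>) = \<Union>((\<lambda>V. \<phi> ` (d \<inter> V)) ` \<V>)" by blast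
    ultimately show "regular_on reg (\<phi> ` (d \<inter> \<Union>\<V>)) (\<lambda>x. f (inv_into d \<phi> x))" by simp
  qed
  show "(\<lambda>_. c) \<in> structure_sheaf reg \<A> V"
    by (auto simp: structure_sheaf_def regular_on_const)
  show "(\<lambda>p. f p + g p) \<in> structure_sheaf reg \<A> V" "(\<lambda>p. f p * g p) \<in> structure_sheaf reg \<A> V"
    if "open V" "f \<in> structure_sheaf reg \<A> V" "g \<in> structure_sheaf reg \<A> V"
    using that op by (auto simp: structure_sheaf_def intro!: regular_on_add regular_on_mult)
qed

section \<open>The sheaf of vector fields\<close>

lemma scale_apply: "(f \<odot> X) p g = f p * X p g" by (simp add: scale_def)
lemma scale_zero [simp]: "(\<lambda>_. 0) \<odot> X = 0" by (simp add: scale_def fun_eq_iff)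
lemma scale_one [simp]: "(\<lambda>_. 1) \<odot> X = X" by (simp add: scale_def)
lemma scale_add: "f \<odot> (X + Y) = f \<odot> X + f \<odot> Y"
  by (simp add: scale_def fun_eq_iff distrib_left)
lemma scale_diff: "f \<odot> (X - Y) = f \<odot> X - f \<odot> Y"
  by (simp add: scale_def fun_eq_iff right_diff_distrib)
lemma scale_commute: "f \<odot> (g \<odot> X) = g \<odot> (f \<odot> X)"
  by (simp add: scale_def fun_eq_iff mult_ac)

lemma res_apply: "res W X p = (if p \<in> W then X p else 0)" by (simp add: res_def)
lemma res_add: "res W (X + Y) = res W X + res W Y" by (auto simp: res_def fun_eq_iff)
lemma res_diff: "res W (X - Y) = res W X - res W Y" by (auto simp: res_def fun_eq_iff)
lemma res_scale: "res W (f \<odot> X) = f \<odot> res W X" by (auto simp: res_def scale_def fun_eq_iff)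
lemma res_res: "res V (res W X) = res (V \<inter> W) X" by (auto simp: res_def fun_eq_iff)

lemma tangent_vector_add:
  "tangent_vector \<O> p v \<Longrightarrow> tangent_vector \<O> p w \<Longrightarrow> tangent_vector \<O> p (v + w)"
  unfolding tangent_vector_def by (safe; simp add: algebra_simps; metis)

lemma tangent_vector_scale: "tangent_vector \<O> p v \<Longrightarrow> tangent_vector \<O> p (\<lambda>f. a * v f)"
  unfolding tangent_vector_def by (safe; simp add: algebra_simps; metis)

lemma tangent_vector_zero: "tangent_vector \<O> p 0"
  unfolding tangent_vector_def by simp


context sheaf_of_algebras
begin

abbreviation "VF \<equiv> vector_fields \<O>"

text \<open>
  A derivation kills 1 because \<open>1 = 1 * 1\<close>, and constants by linearity.
\<close>

lemma tangent_vector_const: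
  assumes "tangent_vector \<O> p v"
  shows "v (\<lambda>_. c) = 0"
proof -
  have reg: "regular_at \<O> p (\<lambda>_. 1)"
    unfolding regular_at_def using sections_const[of 1 UNIV] by auto
  then have "v ((\<lambda>_. 1) * (\<lambda>_. 1)) = 1 * v (\<lambda>_. 1) + 1 * v (\<lambda>_. 1)"
    using assms unfolding tangent_vector_def by blast
  then have "v (\<lambda>_. 1) = 0" by (simp add: times_fun_def)
  moreover have "v (\<lambda>q. c * 1) = c * v (\<lambda>_. 1)"
    using assms reg unfolding tangent_vector_def by blast
  ultimately show ?thesis by simp
qed

lemma VF_zero_outside: "X \<in> VF V \<Longrightarrow> p \<notin> V \<Longrightarrow> X p = 0"
  by (simp add: vector_fields_def)

lemma VF_tangent: "X \<in> VF V \<Longrightarrow> p \<in> V \<Longrightarrow> tangent_vector \<O> p (X p)"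
  by (simp add: vector_fields_def)

lemma VF_section: "X \<in> VF V \<Longrightarrow> open W \<Longrightarrow> W \<subseteq> V \<Longrightarrow> f \<in> \<O> W \<Longrightarrow> (\<lambda>p. X p f) \<in> \<O> W"
  by (simp add: vector_fields_def)

lemma VF_I:
  assumes "\<And>p. p \<in> V \<Longrightarrow> tangent_vector \<O> p (X p)" "\<And>p. p \<notin> V \<Longrightarrow> X p = 0"
    "\<And>W f. open W \<Longrightarrow> W \<subseteq> V \<Longrightarrow> f \<in> \<O> W \<Longrightarrow> (\<lambda>p. X p f) \<in> \<O> W"
  shows "X \<in> VF V"
  using assms by (simp add: vector_fields_def)

lemma VF_add: "X \<in> VF V \<Longrightarrow> Y \<in> VF V \<Longrightarrow> X + Y \<in> VF V"
proof (rule VF_I)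
  assume XY: "X \<in> VF V" "Y \<in> VF V"
  show "tangent_vector \<O> p ((X + Y) p)" if "p \<in> V" for p
    using tangent_vector_add[OF XY[THEN VF_tangent, OF that]] by simp
  show "(X + Y) p = 0" if "p \<notin> V" for p
    using XY[THEN VF_zero_outside, OF that] by (simp only: plus_fun_apply add_0)
  show "(\<lambda>p. (X + Y) p f) \<in> \<O> W" if "open W" "W \<subseteq> V" "f \<in> \<O> W" for W f
    using sections_add[OF that(1) XY[THEN VF_section, OF that]] by simp
qed

lemma VF_scale:
  assumes "f \<in> \<O> V" "X \<in> VF V"
  shows "f \<odot> X \<in> VF V"
proof (rule VF_I)
  show "tangent_vector \<O> p ((f \<odot> X) p)" if "p \<in> V" for p
    using tangent_vector_scale[OF VF_tangent[OF assms(2) that]] by (simp add: scale_def)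
  show "(f \<odot> X) p = 0" if "p \<notin> V" for p
    using VF_zero_outside[OF assms(2) that] by (simp add: scale_def fun_eq_iff)
  show "(\<lambda>p. (f \<odot> X) p g) \<in> \<O> W" if "open W" "W \<subseteq> V" "g \<in> \<O> W" for W g
    unfolding scale_apply
    by (intro sections_mult that(1) sections_restrict[OF assms(1)] VF_section[OF assms(2)] that)
qed

lemma VF_scale_const: "X \<in> VF V \<Longrightarrow> (\<lambda>_. c) \<odot> X \<in> VF V"
  by (rule VF_scale[OF sections_const])

lemma VF_diff:
  assumes "X \<in> VF V" "Y \<in> VF V"
  shows "X - Y \<in> VF V"
proof -
  have "X - Y = X + (\<lambda>_. - 1) \<odot> Y" by (simp add: scale_def fun_eq_iff)
  with assms show ?thesis by (simp only: VF_add VF_scale_const)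
qed

lemma VF_restrict:
  assumes "X \<in> VF V" "W \<subseteq> V"
  shows "res W X \<in> VF W"
proof (rule VF_I)
  show "(\<lambda>p. res W X p f) \<in> \<O> T" if T: "open T" "T \<subseteq> W" "f \<in> \<O> T" for T f
  proof (rule sections_cong[OF T(1)])
    show "(\<lambda>p. X p f) \<in> \<O> T" using VF_section[OF assms(1) T(1)] T assms(2) by blast
  qed (use T in \<open>auto simp: res_apply\<close>)
qed (use VF_tangent[OF assms(1)] assms(2) in \<open>auto simp: res_apply\<close>)

text \<open>
  Being a tangent vector is a condition at each point, and the derivative of a section along \<open>X\<close> is
  regular as soon as it is so near each point.
\<close>

lemma VF_glue:
  assumes outside: "\<And>p. p \<notin> V \<Longrightarrow> X p = 0"
    and local: "\<And>p. p \<in> V \<Longrightarrow> \<exists>W. open W \<and> p \<in> W \<and> W \<subseteq> V \<and> res W X \<in> VF W"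
  shows "X \<in> VF V"
proof (rule VF_I)
  show "tangent_vector \<O> p (X p)" if p: "p \<in> V" for p
  proof -
    obtain W where "p \<in> W" "res W X \<in> VF W" using local[OF p] by blast
    then show ?thesis using VF_tangent[of "res W X" W p] by (simp add: res_apply)
  qed
  show "(\<lambda>p. X p f) \<in> \<O> T" if T: "open T" "T \<subseteq> V" "f \<in> \<O> T" for T f
  proof -
    define \<W> where "\<W> = {T \<inter> W | W. open W \<and> W \<subseteq> V \<and> res W X \<in> VF W}"
    have "\<Union>\<W> = T"
    proof
      show "T \<subseteq> \<Union>\<W>"
      proof
        fix p assume "p \<in> T"
        then obtain W where "open W" "p \<in> W" "W \<subseteq> V" "res W X \<in> VF W"
          using local[OF subsetD[OF T(2)]] by blast
        then show "p \<in> \<Union>\<W>" using \<open>p \<in> T\<close> unfolding \<W>_def by blast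
      qed
    qed (auto simp: \<W>_def)
    moreover have "(\<lambda>p. X p f) \<in> \<O> (\<Union>\<W>)"
    proof (rule sections_glue)
      fix Q assume "Q \<in> \<W>"
      then obtain W where W: "Q = T \<inter> W" "open W" "res W X \<in> VF W" unfolding \<W>_def by blast
      show Q: "open Q" using W T by auto
      have "f \<in> \<O> Q" by (rule sections_restrict[OF T(3)]) (use W in blast)
      then have "(\<lambda>p. res W X p f) \<in> \<O> Q"
        using W(1) by (intro VF_section[OF W(3) Q]) simp_all
      then show "(\<lambda>p. X p f) \<in> \<O> Q"
        by (rule sections_cong[OF Q]) (simp add: res_apply W)
    qed
    ultimately show ?thesis by simp
  qed
qed (rule outside)

lemma VF_ext:
  assumes "X \<in> VF V" "Y \<in> VF V" "\<And>p. p \<in> V \<Longrightarrow> \<exists>W. p \<in> W \<and> res W X = res W Y"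
  shows "X = Y"
proof
  fix p
  show "X p = Y p"
  proof (cases "p \<in> V")
    case True
    then obtain W where "p \<in> W" "res W X = res W Y" using assms(3) by blast
    then show ?thesis by (metis res_apply)
  next
    case False
    then show ?thesis using VF_zero_outside assms(1,2) by metis
  qed
qed

text \<open>
  Consequently a connection is linear over the constants in its second argument as well.
\<close>

lemma act_const: "X \<in> VF V \<Longrightarrow> act X (\<lambda>_. c) \<odot> Y = 0"
proof -
  assume X: "X \<in> VF V"
  have "X p (\<lambda>_. c) = 0" for p
    using tangent_vector_const[OF VF_tangent[OF X]] VF_zero_outside[OF X]
    by (cases "p \<in> V") simp_all
  then show ?thesis by (simp add: act_def scale_def fun_eq_iff)
qed

end

section \<open>Invertible endomorphisms of the tangent sheaf\<close>

text \<open>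
  This locale applies to the multiplication by \<open>E\<close> shifted by a constant. For such maps bijectivity on
  sections is a local property, so that the inverse exists on the whole invertible locus, although the
  latter is defined as a mere union of open sets on which it exists.
\<close>

locale sheaf_endomorphism = sheaf_of_algebras +
  fixes U :: "'a set" and F :: "('a, 'b) endo"
  assumes endo_VF: "open V \<Longrightarrow> V \<subseteq> U \<Longrightarrow> X \<in> VF V \<Longrightarrow> F V X \<in> VF V"
    and endo_res: "open V \<Longrightarrow> V \<subseteq> U \<Longrightarrow> X \<in> VF V \<Longrightarrow> open W \<Longrightarrow> W \<subseteq> V \<Longrightarrow> res W (F V X) = F W (res W X)"
    and endo_add: "open V \<Longrightarrow> V \<subseteq> U \<Longrightarrow> X \<in> VF V \<Longrightarrow> Y \<in> VF V \<Longrightarrow> F V (X + Y) = F V X + F V Y"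
    and endo_scale: "open V \<Longrightarrow> V \<subseteq> U \<Longrightarrow> f \<in> \<O> V \<Longrightarrow> X \<in> VF V \<Longrightarrow> F V (f \<odot> X) = f \<odot> F V X"
begin

lemma invertible_locus_subset: "invertible_locus \<O> U F \<subseteq> U"
  unfolding invertible_locus_def by auto

lemma invertible_locusE:
  assumes "p \<in> invertible_locus \<O> U F"
  obtains W where "open W" "p \<in> W" "W \<subseteq> U" "invertible_on \<O> W F"
  using assms unfolding invertible_locus_def by auto

text \<open>
  Injectivity is inherited from a cover because sections that agree locally are equal. For surjectivity
  the local preimages agree on overlaps by injectivity, hence glue.
\<close>

lemma invertible_on_invertible_locus: "invertible_on \<O> (invertible_locus \<O> U F) F"
  unfolding invertible_on_def
proof safe
  fix V assume V: "open V" "V \<subseteq> invertible_locus \<O> U F"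
  then have VU: "V \<subseteq> U" using invertible_locus_subset by blast
  have nbhd: "\<exists>W. open W \<and> p \<in> W \<and> W \<subseteq> V \<and> invertible_on \<O> W F" if p: "p \<in> V" for p
  proof -
    obtain W where "open W" "p \<in> W" "invertible_on \<O> W F"
      using invertible_locusE[OF subsetD[OF V(2) p]] by metis
    then show ?thesis
      using V(1) p by (intro exI[of _ "V \<inter> W"]) (auto simp: invertible_on_def)
  qed
  have inj: "inj_on (F T) (VF T)" if "open T" "T \<subseteq> V" for T
  proof (rule inj_onI)
    fix X Y assume XY: "X \<in> VF T" "Y \<in> VF T" "F T X = F T Y"
    have TU: "T \<subseteq> U" using that VU by blast
    show "X = Y"
    proof (rule VF_ext[OF XY(1,2)])
      fix p assume "p \<in> T"
      then obtain W where W: "open W" "p \<in> W" "invertible_on \<O> W F" using nbhd \<open>T \<subseteq> V\<close> by blast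
      let ?Q = "T \<inter> W"
      have Q: "open ?Q" "?Q \<subseteq> T" "?Q \<subseteq> W" using W that by auto
      have "F ?Q (res ?Q X) = F ?Q (res ?Q Y)"
        using XY(3) endo_res[OF that(1) TU XY(1) Q(1,2)] endo_res[OF that(1) TU XY(2) Q(1,2)] by simp
      moreover have "inj_on (F ?Q) (VF ?Q)"
        using W(3) Q unfolding invertible_on_def bij_betw_def by blast
      ultimately have "res ?Q X = res ?Q Y"
        using VF_restrict[OF XY(1) Q(2)] VF_restrict[OF XY(2) Q(2)] by (simp add: inj_on_eq_iff)
      then show "\<exists>W. p \<in> W \<and> res W X = res W Y" using \<open>p \<in> T\<close> W(2) by blast
    qed
  qed
  have "F V ` VF V = VF V"
  proof safe
    fix Y assume Y: "Y \<in> VF V"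
    \<comment> \<open>A neighbourhood \<open>N p\<close> of each point is chosen with the preimage \<open>S p\<close> of \<open>Y\<close> over it; the
      value at \<open>q\<close> of the glued field is that of \<open>S q\<close>.\<close>
    define N where "N p = (SOME W. open W \<and> p \<in> W \<and> W \<subseteq> V \<and> invertible_on \<O> W F)" for p
    have N: "open (N p)" "p \<in> N p" "N p \<subseteq> V" "invertible_on \<O> (N p) F" if "p \<in> V" for p
      using someI_ex[OF nbhd[OF that]] unfolding N_def by auto
    define S where "S p = inv_into (VF (N p)) (F (N p)) (res (N p) Y)" for p
    have S: "S p \<in> VF (N p)" "F (N p) (S p) = res (N p) Y" if "p \<in> V" for p
    proof -
      have "F (N p) ` VF (N p) = VF (N p)"
        using N[OF that] unfolding invertible_on_def bij_betw_def by blast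
      then have "res (N p) Y \<in> F (N p) ` VF (N p)"
        using VF_restrict[OF Y N(3)[OF that]] by simp
      then show "S p \<in> VF (N p)" "F (N p) (S p) = res (N p) Y"
        unfolding S_def by (rule inv_into_into, rule f_inv_into_f)
    qed
    have agree: "S p q = S q q" if p: "p \<in> V" and q: "q \<in> N p" for p q
    proof -
      have qV: "q \<in> V" using N(3)[OF p] q by blast
      let ?Q = "N p \<inter> N q"
      have Q: "open ?Q" "?Q \<subseteq> N p" "?Q \<subseteq> N q" "?Q \<subseteq> V" using N[OF p] N[OF qV] by auto
      have sub: "N p \<subseteq> U" "N q \<subseteq> U" using N(3)[OF p] N(3)[OF qV] VU by auto
      have "F ?Q (res ?Q (S p)) = res ?Q (res (N p) Y)"
        using endo_res[OF N(1)[OF p] sub(1) S(1)[OF p] Q(1,2)] S(2)[OF p] by simp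
      also have "\<dots> = res ?Q (res (N q) Y)" by (simp add: res_res Int_ac)
      also have "\<dots> = F ?Q (res ?Q (S q))"
        using endo_res[OF N(1)[OF qV] sub(2) S(1)[OF qV] Q(1,3)] S(2)[OF qV] by simp
      finally have "res ?Q (S p) = res ?Q (S q)"
        by (rule inj_onD[OF inj[OF Q(1,4)]])
           (rule VF_restrict[OF S(1)[OF p] Q(2)] VF_restrict[OF S(1)[OF qV] Q(3)])+
      then show ?thesis using q N(2)[OF qV] by (metis IntI res_apply)
    qed
    define X where "X q = (if q \<in> V then S q q else 0)" for q
    have res_X: "res (N p) X = S p" if "p \<in> V" for p
    proof
      fix q show "res (N p) X q = S p q"
        using agree[OF that, of q] N(3)[OF that] VF_zero_outside[OF S(1)[OF that], of q]
        by (auto simp: res_apply X_def)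
    qed
    have X: "X \<in> VF V"
    proof (rule VF_glue)
      show "\<exists>W. open W \<and> p \<in> W \<and> W \<subseteq> V \<and> res W X \<in> VF W" if "p \<in> V" for p
        using N[OF that] S(1)[OF that] res_X[OF that] by metis
    qed (simp add: X_def)
    have "F V X = Y"
    proof (rule VF_ext[OF endo_VF[OF V(1) VU X] Y])
      fix p assume p: "p \<in> V"
      have "res (N p) (F V X) = res (N p) Y"
        using endo_res[OF V(1) VU X N(1,3)[OF p]] by (simp add: res_X[OF p] S(2)[OF p])
      then show "\<exists>W. p \<in> W \<and> res W (F V X) = res W Y" using N(2)[OF p] by blast
    qed
    then show "Y \<in> F V ` VF V" using X by blast
  qed (rule endo_VF[OF V(1) VU])
  with inj[OF V(1)] show "bij_betw (F V) (VF V) (VF V)"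
    by (simp add: bij_betw_def)
qed

context
  fixes V assumes V: "open V" "V \<subseteq> invertible_locus \<O> U F"
begin

lemma V_subset: "V \<subseteq> U"
  using V(2) invertible_locus_subset by blast

lemma bij_endo: "bij_betw (F V) (VF V) (VF V)"
  using invertible_on_invertible_locus V unfolding invertible_on_def by blast

lemma inverse_endo_VF: "X \<in> VF V \<Longrightarrow> inverse_endo \<O> F V X \<in> VF V"
  unfolding inverse_endo_def using bij_endo by (metis bij_betw_def inv_into_into)

lemma endo_inverse_endo: "X \<in> VF V \<Longrightarrow> F V (inverse_endo \<O> F V X) = X"
  unfolding inverse_endo_def using bij_endo by (simp add: bij_betw_inv_into_right)

lemma inverse_endo_endo: "X \<in> VF V \<Longrightarrow> inverse_endo \<O> F V (F V X) = X"
  unfolding inverse_endo_def using bij_endo by (simp add: bij_betw_inv_into_left)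

lemma inverse_endo_add:
  assumes "X \<in> VF V" "Y \<in> VF V"
  shows "inverse_endo \<O> F V (X + Y) = inverse_endo \<O> F V X + inverse_endo \<O> F V Y"
  using inverse_endo_endo[OF VF_add[OF assms[THEN inverse_endo_VF]]]
  by (simp add: endo_add[OF V(1) V_subset] inverse_endo_VF endo_inverse_endo assms)

lemma inverse_endo_scale:
  assumes "f \<in> \<O> V" "X \<in> VF V"
  shows "inverse_endo \<O> F V (f \<odot> X) = f \<odot> inverse_endo \<O> F V X"
  using inverse_endo_endo[OF VF_scale[OF assms(1) inverse_endo_VF[OF assms(2)]]]
  by (simp add: endo_scale[OF V(1) V_subset] inverse_endo_VF endo_inverse_endo assms)

end

lemma inverse_endo_res:
  assumes V: "open V" "V \<subseteq> invertible_locus \<O> U F" and W: "open W" "W \<subseteq> V" and X: "X \<in> VF V"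
  shows "res W (inverse_endo \<O> F V X) = inverse_endo \<O> F W (res W X)"
proof -
  have W': "W \<subseteq> invertible_locus \<O> U F" using V W by blast
  note Y = inverse_endo_VF[OF V X]
  have "inverse_endo \<O> F W (F W (res W (inverse_endo \<O> F V X))) = res W (inverse_endo \<O> F V X)"
    by (rule inverse_endo_endo[OF W(1) W' VF_restrict[OF Y W(2)]])
  then show ?thesis
    by (simp add: endo_res[OF V(1) V_subset[OF V] Y W, symmetric] endo_inverse_endo[OF V X])
qed

end

section \<open>The algebra of a bi-flat structure\<close>

text \<open>
  The algebra of vector fields over a fixed open set on which both structures are defined: \<open>A\<close> is the
  set of vector fields, \<open>D\<close> and \<open>D'\<close> are the two connections \<open>\<nabla>\<close> and \<open>\<nabla>*\<close>. Both are torsionless, so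
  the Lie bracket is written as \<open>D X Y - D Y X\<close>; then \<open>same_bracket\<close> says that they have the same
  torsion. The axiom \<open>D_m_compatible\<close> is the coefficient of \<open>c\<close> in the curvature of the connection
  \<open>D X Y - c (X \<star> Y)\<close>, which is flat for all \<open>c\<close>. Functions do not occur: the computation
  below is additive, and tensors appear only through values on all vector fields.
\<close>

locale bi_flat_algebra =
  fixes A :: "'a::ab_group_add set"
    and m :: "'a \<Rightarrow> 'a \<Rightarrow> 'a" (infixl "\<star>" 70)
    and D D' :: "'a \<Rightarrow> 'a \<Rightarrow> 'a"
    and e E :: 'a
  assumes e [simp]: "e \<in> A" and E [simp]: "E \<in> A"
    and minus_mem [simp]: "X \<in> A \<Longrightarrow> Y \<in> A \<Longrightarrow> X - Y \<in> A"
    and m_mem [simp]: "X \<in> A \<Longrightarrow> Y \<in> A \<Longrightarrow> X \<star> Y \<in> A"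
    and D_mem [simp]: "X \<in> A \<Longrightarrow> Y \<in> A \<Longrightarrow> D X Y \<in> A"
    and D'_mem [simp]: "X \<in> A \<Longrightarrow> Y \<in> A \<Longrightarrow> D' X Y \<in> A"
    and m_add: "X \<in> A \<Longrightarrow> Y \<in> A \<Longrightarrow> Z \<in> A \<Longrightarrow> X \<star> (Y + Z) = X \<star> Y + X \<star> Z"
    and D_add: "X \<in> A \<Longrightarrow> Y \<in> A \<Longrightarrow> Z \<in> A \<Longrightarrow> D X (Y + Z) = D X Y + D X Z"
    and D_add_left: "X \<in> A \<Longrightarrow> Y \<in> A \<Longrightarrow> Z \<in> A \<Longrightarrow> D (X + Y) Z = D X Z + D Y Z"
    and D'_add: "X \<in> A \<Longrightarrow> Y \<in> A \<Longrightarrow> Z \<in> A \<Longrightarrow> D' X (Y + Z) = D' X Y + D' X Z"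
    and D'_add_left: "X \<in> A \<Longrightarrow> Y \<in> A \<Longrightarrow> Z \<in> A \<Longrightarrow> D' (X + Y) Z = D' X Z + D' Y Z"
    and m_commute: "X \<in> A \<Longrightarrow> Y \<in> A \<Longrightarrow> X \<star> Y = Y \<star> X"
    and m_assoc: "X \<in> A \<Longrightarrow> Y \<in> A \<Longrightarrow> Z \<in> A \<Longrightarrow> X \<star> Y \<star> Z = X \<star> (Y \<star> Z)"
    and e_unit [simp]: "X \<in> A \<Longrightarrow> e \<star> X = X"
    and flat_D: "X \<in> A \<Longrightarrow> Y \<in> A \<Longrightarrow> Z \<in> A \<Longrightarrow>
      D X (D Y Z) - D Y (D X Z) - D (D X Y - D Y X) Z = 0"
    and flat_D': "X \<in> A \<Longrightarrow> Y \<in> A \<Longrightarrow> Z \<in> A \<Longrightarrow>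
      D' X (D' Y Z) - D' Y (D' X Z) - D' (D' X Y - D' Y X) Z = 0"
    and same_bracket: "X \<in> A \<Longrightarrow> Y \<in> A \<Longrightarrow> D' X Y - D' Y X = D X Y - D Y X"
    and D_m_compatible: "X \<in> A \<Longrightarrow> Y \<in> A \<Longrightarrow> Z \<in> A \<Longrightarrow>
      D X (Y \<star> Z) - D Y (X \<star> Z) + X \<star> D Y Z - Y \<star> D X Z - (D X Y - D Y X) \<star> Z = 0"
    and D_e [simp]: "X \<in> A \<Longrightarrow> D X e = 0"
    and D'_E [simp]: "X \<in> A \<Longrightarrow> D' X E = 0"
    and Euler: "X \<in> A \<Longrightarrow> Y \<in> A \<Longrightarrow>
      (D E (X \<star> Y) - D (X \<star> Y) E) - (D E X - D X E) \<star> Y - X \<star> (D E Y - D Y E) = X \<star> Y"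
    and same_differential: "X \<in> A \<Longrightarrow> Y \<in> A \<Longrightarrow> Z \<in> A \<Longrightarrow>
      D Y (X \<star> Z) - D Z (X \<star> Y) = D' Y (X \<star> Z) - D' Z (X \<star> Y)"
begin

lemma zero_mem [simp]: "0 \<in> A"
  using minus_mem[OF e e] by simp

lemma uminus_mem [simp]: "X \<in> A \<Longrightarrow> - X \<in> A"
  using minus_mem[OF zero_mem, of X] by simp

lemma add_mem [simp]: "X \<in> A \<Longrightarrow> Y \<in> A \<Longrightarrow> X + Y \<in> A"
  using minus_mem[OF _ uminus_mem, of X Y] by simp

lemma m_add_left: "X \<in> A \<Longrightarrow> Y \<in> A \<Longrightarrow> Z \<in> A \<Longrightarrow> (X + Y) \<star> Z = X \<star> Z + Y \<star> Z"
  using m_add[of Z X Y] by (simp add: m_commute[of _ Z])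

lemma additive_on_diff:
  assumes "\<And>X Y. X \<in> A \<Longrightarrow> Y \<in> A \<Longrightarrow> F (X + Y) = F X + (F Y :: 'a)" "X \<in> A" "Y \<in> A"
  shows "F (X - Y) = F X - F Y"
  using assms(1)[of "X - Y" Y] assms(2,3) by (simp add: algebra_simps)

lemmas m_diff = additive_on_diff[of "\<lambda>Y. Z \<star> Y" for Z, OF m_add]
lemmas m_diff_left = additive_on_diff[of "\<lambda>Y. Y \<star> Z" for Z, OF m_add_left]
lemmas D_diff = additive_on_diff[of "D Z" for Z, OF D_add]
lemmas D_diff_left = additive_on_diff[of "\<lambda>Y. D Y Z" for Z, OF D_add_left]
lemmas D'_diff = additive_on_diff[of "D' Z" for Z, OF D'_add]
lemmas D'_diff_left = additive_on_diff[of "\<lambda>Y. D' Y Z" for Z, OF D'_add_left]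

lemma additive_on_zero:
  assumes "\<And>X Y. X \<in> A \<Longrightarrow> Y \<in> A \<Longrightarrow> F (X + Y) = F X + (F Y :: 'a)"
  shows "F 0 = 0"
  using assms[of 0 0] by simp

lemmas D_zero_left = additive_on_zero[of "\<lambda>Y. D Y Z" for Z, OF D_add_left]

lemma additive_on_uminus:
  assumes "\<And>X Y. X \<in> A \<Longrightarrow> Y \<in> A \<Longrightarrow> F (X + Y) = F X + (F Y :: 'a)" "X \<in> A"
  shows "F (- X) = - F X"
  using additive_on_diff[of F 0 X] additive_on_zero[of F] assms by simp

lemmas m_uminus = additive_on_uminus[of "\<lambda>Y. Z \<star> Y" for Z, OF m_add]
lemmas m_uminus_left = additive_on_uminus[of "\<lambda>Y. Y \<star> Z" for Z, OF m_add_left]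
lemmas D_uminus = additive_on_uminus[of "D Z" for Z, OF D_add]
lemmas D'_uminus_left = additive_on_uminus[of "\<lambda>Y. D' Y Z" for Z, OF D'_add_left]

lemmas linear = m_add m_add_left m_diff m_diff_left m_uminus m_uminus_left
  D_add D_add_left D_diff D_diff_left D_uminus
  D'_add D'_add_left D'_diff D'_diff_left D'_uminus_left

lemma m_left_commute: "X \<in> A \<Longrightarrow> Y \<in> A \<Longrightarrow> Z \<in> A \<Longrightarrow> X \<star> (Y \<star> Z) = Y \<star> (X \<star> Z)"
  using m_assoc[of X Y Z] m_assoc[of Y X Z] m_commute[of X Y] by simp

lemmas m_ac = m_assoc m_commute m_left_commute

lemma e_unit_right [simp]: "X \<in> A \<Longrightarrow> X \<star> e = X"
  using m_commute[of X e] by simp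

text \<open>
  \<open>K\<close> is the covariant derivative of the unit \<open>e\<close> for the second connection, \<open>S\<close> that of the unit
  \<open>E\<close> for the first. Each is the obstruction for a unit to be parallel for the wrong connection, and
  together they control the difference of the two connections.
\<close>

definition K where "K X = D' X e"
definition S where "S X = D X E"

lemma K_mem [simp]: "X \<in> A \<Longrightarrow> K X \<in> A" by (simp add: K_def)
lemma S_mem [simp]: "X \<in> A \<Longrightarrow> S X \<in> A" by (simp add: S_def)

lemma K_add: "X \<in> A \<Longrightarrow> Y \<in> A \<Longrightarrow> K (X + Y) = K X + K Y" by (simp add: K_def linear)
lemma S_add: "X \<in> A \<Longrightarrow> Y \<in> A \<Longrightarrow> S (X + Y) = S X + S Y" by (simp add: S_def linear)
lemma K_diff: "X \<in> A \<Longrightarrow> Y \<in> A \<Longrightarrow> K (X - Y) = K X - K Y" by (simp add: K_def linear)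
lemma S_diff: "X \<in> A \<Longrightarrow> Y \<in> A \<Longrightarrow> S (X - Y) = S X - S Y" by (simp add: S_def linear)
lemma K_uminus: "X \<in> A \<Longrightarrow> K (- X) = - K X" by (simp add: K_def linear)
lemmas KS_linear = K_add S_add K_diff S_diff K_uminus

text \<open>
  The tensor \<open>T X Y = D' X Y - D X Y\<close> is symmetric, and \<open>same_differential\<close> says that
  \<open>T Y (X \<star> Z) = T Z (X \<star> Y)\<close>. Putting \<open>Z = e\<close> gives
  \<open>T Y X = T e (X \<star> Y) = T (X \<star> Y) e\<close>, and \<open>e\<close> is parallel for \<open>D\<close>.
\<close>

lemma D'_eq:
  assumes [simp]: "X \<in> A" "Y \<in> A"
  shows "D' X Y = D X Y + K (X \<star> Y)"
proof -
  have "D X Y - D e (X \<star> Y) = D' X Y - D' e (X \<star> Y)"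
    using same_differential[of Y X e] by (simp add: m_commute)
  then have "D' X Y = D X Y - D e (X \<star> Y) + D' e (X \<star> Y)"
    by (simp add: algebra_simps)
  moreover have "D' e (X \<star> Y) = K (X \<star> Y) + D e (X \<star> Y)"
    using same_bracket[of "X \<star> Y" e] by (simp add: K_def algebra_simps)
  ultimately show ?thesis
    by simp
qed

text \<open>
  The same formula evaluated at \<open>E\<close>, which is parallel for \<open>D'\<close>.
\<close>

lemma K_E:
  assumes [simp]: "X \<in> A"
  shows "K (E \<star> X) = - S X"
  using D'_eq[of X E] by (simp add: S_def m_commute eq_neg_iff_add_eq_0 add.commute)

text \<open>
  This computes the covariant derivative of \<open>L = E\<star>\<close>. By \<open>D_m_compatible\<close> the tensor \<open>D(\<star>)\<close> is
  symmetric in all three arguments, so differentiating the product in direction \<open>X\<close> with one factor \<open>E\<close>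
  amounts to differentiating it in direction \<open>E\<close>; the latter is given by the Euler condition.
\<close>

lemma D_E_m:
  assumes [simp]: "X \<in> A" "W \<in> A"
  shows "D X (E \<star> W) = E \<star> D X W + X \<star> W + S (X \<star> W) - X \<star> S W"
proof -
  have "D X (E \<star> W) - (E \<star> D X W + X \<star> W + S (X \<star> W) - X \<star> S W) =
    (D X (E \<star> W) - D E (X \<star> W) + X \<star> D E W - E \<star> D X W - (D X E - D E X) \<star> W)
    + ((D E (X \<star> W) - D (X \<star> W) E) - (D E X - D X E) \<star> W - X \<star> (D E W - D W E)) - X \<star> W"
    by (simp add: S_def linear algebra_simps)
  also have "\<dots> = 0"
    unfolding Euler[OF assms] D_m_compatible[OF assms(1) E assms(2)] by simp
  finally show ?thesis by simp
qed

text \<open>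
  The Nijenhuis torsion of \<open>L = E\<star>\<close> vanishes: after inserting the derivative of \<open>L\<close>, the terms in
  which \<open>S\<close> is applied to a product are symmetric in \<open>X\<close> and \<open>Y\<close>, and the others cancel by associativity.
\<close>

lemma Nijenhuis:
  assumes [simp]: "X \<in> A" "Y \<in> A"
  shows "D (E \<star> X) (E \<star> Y) - D (E \<star> Y) (E \<star> X) =
    E \<star> (D (E \<star> X) Y - D Y (E \<star> X) + (D X (E \<star> Y) - D (E \<star> Y) X) - E \<star> (D X Y - D Y X))"
  by (simp add: D_E_m linear m_ac algebra_simps)

lemma D_e_m:
  assumes [simp]: "X \<in> A" "W \<in> A"
  shows "D e (X \<star> W) = X \<star> D e W + D e X \<star> W"
  using D_m_compatible[of e X W] by (simp add: linear algebra_simps)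

text \<open>
  The curvature of \<open>D'\<close> in the directions \<open>X\<close> and \<open>e\<close>, expanded around \<open>D\<close>. It expresses the covariant
  derivative of \<open>K\<close> in direction \<open>X\<close> by the one in direction \<open>e\<close>. That \<open>D e\<close> is a derivation of the
  product brings the terms with \<open>D e X\<close> and \<open>D e Z\<close> into a single one.
\<close>

lemma D_K:
  assumes [simp]: "X \<in> A" "Z \<in> A"
  shows "D X (K Z) = K (D X Z) + D e (K (X \<star> Z)) - K (D e (X \<star> Z)) - K (X \<star> K Z) + K (K (X \<star> Z))"
proof -
  have "D X (K Z) - (K (D X Z) + D e (K (X \<star> Z)) - K (D e (X \<star> Z)) - K (X \<star> K Z) + K (K (X \<star> Z)))
     = (D' X (D' e Z) - D' e (D' X Z) - D' (D' X e - D' e X) Z)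
     - (D X (D e Z) - D e (D X Z) - D (D X e - D e X) Z)"
    unfolding same_bracket[OF assms(1) e]
    by (simp add: D'_eq D_e_m linear KS_linear algebra_simps)
  also have "\<dots> = 0" by (simp add: flat_D flat_D' del: D_e D'_E)
  finally show ?thesis by simp
qed

text \<open>
  \<open>G V\<close> collects what remains of \<open>D X (S W) - S (D X W)\<close> when \<open>X \<star> W = V\<close>. Only the fact that this
  expression depends on \<open>X\<close> and \<open>W\<close> through their product is used afterwards.
\<close>

definition G where "G V = - K V - D e (K (E \<star> V)) + K (D e (E \<star> V))"

text \<open>
  Differentiate \<open>S W = - K (E \<star> W)\<close>: the derivative of \<open>L\<close> contributes \<open>K (X \<star> S W)\<close> and
  \<open>K (S (X \<star> W))\<close>, and the derivative of \<open>K\<close> contributes the same terms with opposite signs, because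
  \<open>K (E \<star> _)\<close> is \<open>- S\<close>.
\<close>

lemma D_S:
  assumes [simp]: "X \<in> A" "W \<in> A"
  shows "D X (S W) = S (D X W) + G (X \<star> W)"
proof -
  have SW: "S W = - K (E \<star> W)" by (simp add: K_E)
  have "D X (S W) = - D X (K (E \<star> W))" by (simp add: SW linear)
  also have "\<dots> = - (K (D X (E \<star> W)) + D e (K (X \<star> (E \<star> W))) - K (D e (X \<star> (E \<star> W))) - K (X \<star> K (E \<star> W)) + K (K (X \<star> (E \<star> W))))"
    by (simp only: D_K m_mem assms E)
  also have "X \<star> (E \<star> W) = E \<star> (X \<star> W)" by (simp add: m_ac)
  finally show ?thesis
    by (simp add: D_E_m G_def K_E linear KS_linear algebra_simps)
qed

text \<open>
  This is \<open>D_m_compatible\<close> with \<open>S\<close> applied to the products. The two differ by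
  \<open>G (X \<star> (Y \<star> Z)) - G (Y \<star> (X \<star> Z))\<close>, which is 0.
\<close>

lemma S_compatible:
  assumes [simp]: "X \<in> A" "Y \<in> A" "Z \<in> A"
  shows "D X (S (Y \<star> Z)) - D Y (S (X \<star> Z)) + S (X \<star> D Y Z) - S (Y \<star> D X Z) - S ((D X Y - D Y X) \<star> Z) = 0"
proof -
  have "X \<star> (Y \<star> Z) = Y \<star> (X \<star> Z)" by (simp add: m_ac)
  then have "D X (S (Y \<star> Z)) - D Y (S (X \<star> Z)) + S (X \<star> D Y Z) - S (Y \<star> D X Z) - S ((D X Y - D Y X) \<star> Z)
    = S (D X (Y \<star> Z) - D Y (X \<star> Z) + X \<star> D Y Z - Y \<star> D X Z - (D X Y - D Y X) \<star> Z)"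
    by (simp add: D_S KS_linear)
  also have "\<dots> = S 0" by (simp only: D_m_compatible assms)
  finally show ?thesis by (simp add: S_def D_zero_left)
qed

end

text \<open>
  A constant scalar enters only through multiplication by it, here \<open>s\<close>; it commutes with all
  operations.
\<close>

locale scaled_bi_flat_algebra = bi_flat_algebra +
  fixes s :: "'a \<Rightarrow> 'a"
  assumes s_mem [simp]: "X \<in> A \<Longrightarrow> s X \<in> A"
    and s_add: "X \<in> A \<Longrightarrow> Y \<in> A \<Longrightarrow> s (X + Y) = s X + s Y"
    and s_m: "X \<in> A \<Longrightarrow> Y \<in> A \<Longrightarrow> m X (s Y) = s (m X Y)"
    and s_D: "X \<in> A \<Longrightarrow> Y \<in> A \<Longrightarrow> D X (s Y) = s (D X Y)"
    and s_D_left: "X \<in> A \<Longrightarrow> Y \<in> A \<Longrightarrow> D (s X) Y = s (D X Y)"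
    and s_D': "X \<in> A \<Longrightarrow> Y \<in> A \<Longrightarrow> D' X (s Y) = s (D' X Y)"
    and s_D'_left: "X \<in> A \<Longrightarrow> Y \<in> A \<Longrightarrow> D' (s X) Y = s (D' X Y)"
begin

lemma s_m_left: "X \<in> A \<Longrightarrow> Y \<in> A \<Longrightarrow> m (s X) Y = s (m X Y)"
  using s_m[of Y X] by (simp add: m_commute)

lemmas s_diff = additive_on_diff[of s, OF s_add]
lemmas s_linear = s_add s_diff s_m s_m_left s_D s_D_left s_D' s_D'_left

text \<open>
  Let \<open>L = E\<star>\<close>. In terms of \<open>shift = L - s\<close> the Gauss-Manin connection takes the form
  \<open>\<nabla>GM (shift X) Y = pencil X Y\<close>, in which no inverse occurs, see \<open>pencil_eq\<close>. The
  \<open>shift_bracket\<close> is the Lie bracket of the Lie algebroid structure that \<open>shift\<close> defines on the tangent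
  bundle: it is obtained from the usual bracket by deforming it with \<open>shift\<close>.
\<close>

definition shift where "shift X = m E X - s X"
definition pencil where "pencil X Y = D' (m E X) Y - s (D X Y)"
definition shift_bracket where "shift_bracket X Y =
   (D (m E X) Y - D Y (m E X)) + (D X (m E Y) - D (m E Y) X) - m E (D X Y - D Y X) - s (D X Y - D Y X)"

lemma shift_mem [simp]: "X \<in> A \<Longrightarrow> shift X \<in> A" by (simp add: shift_def)
lemma shift_bracket_mem [simp]: "X \<in> A \<Longrightarrow> Y \<in> A \<Longrightarrow> shift_bracket X Y \<in> A" by (simp add: shift_bracket_def)

text \<open>
  Adding a constant multiple of the identity does not change the Nijenhuis torsion of \<open>L\<close>.
\<close>

lemma bracket_shift:
  assumes [simp]: "X \<in> A" "Y \<in> A"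
  shows "D (shift X) (shift Y) - D (shift Y) (shift X) = shift (shift_bracket X Y)"
proof -
  have "D (shift X) (shift Y) - D (shift Y) (shift X) - shift (shift_bracket X Y)
    = (D (m E X) (m E Y) - D (m E Y) (m E X)) -
      m E (D (m E X) Y - D Y (m E X) + (D X (m E Y) - D (m E Y) X) - m E (D X Y - D Y X))"
    by (simp add: shift_def shift_bracket_def linear s_linear algebra_simps)
  also have "\<dots> = 0" using Nijenhuis[OF assms] by simp
  finally show ?thesis by simp
qed

text \<open>
  The curvature of \<open>pencil\<close>, seen as a Lie algebroid connection, is a quadratic polynomial in \<open>s\<close>. Its
  constant term is the curvature of \<open>D'\<close> at \<open>L X\<close> and \<open>L Y\<close>, its quadratic term that of \<open>D\<close> at \<open>X\<close>
  and \<open>Y\<close>. In the linear term \<open>r1\<close> the contributions of \<open>D\<close> are again curvatures, and those of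
  \<open>D' - D\<close>, which is \<open>- S (X \<star> Z)\<close> at \<open>L X\<close> and \<open>Z\<close>, vanish by \<open>S_compatible\<close>.
\<close>

lemma flat_pencil:
  assumes [simp]: "X \<in> A" "Y \<in> A" "Z \<in> A"
  shows "pencil X (pencil Y Z) - pencil Y (pencil X Z) - pencil (shift_bracket X Y) Z = 0"
proof -
  let ?LX = "m E X" and ?LY = "m E Y"
  let ?b = "D X Y - D Y X"
  let ?B = "(D ?LX Y - D Y ?LX) + (D X ?LY - D ?LY X) - m E ?b"
  have r2: "D X (D Y Z) - D Y (D X Z) - D ?b Z = 0" by (simp add: flat_D)
  have r0: "D' ?LX (D' ?LY Z) - D' ?LY (D' ?LX Z) - D' (m E ?B) Z = 0"
    using flat_D'[of ?LX ?LY Z] by (simp add: same_bracket Nijenhuis)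
  have r1: "D' ?LX (D Y Z) + D X (D' ?LY Z) - D' ?LY (D X Z) - D Y (D' ?LX Z) - D ?B Z - D' (m E ?b) Z = 0"
    (is "?r1 = 0")
  proof -
    have D'E: "D' (m E V) W = D (m E V) W - S (m V W)" if "V \<in> A" "W \<in> A" for V W
      using that by (simp add: D'_eq m_assoc K_E)
    have "?r1 = (D ?LX (D Y Z) - D Y (D ?LX Z) - D (D ?LX Y - D Y ?LX) Z)
       + (D X (D ?LY Z) - D ?LY (D X Z) - D (D X ?LY - D ?LY X) Z)
       - (D X (S (m Y Z)) - D Y (S (m X Z)) + S (m X (D Y Z)) - S (m Y (D X Z)) - S (m ?b Z))"
      by (simp add: D'E linear KS_linear algebra_simps)
    also have "\<dots> = 0" by (simp only: flat_D S_compatible assms m_mem E) simp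
    finally show ?thesis .
  qed
  have "pencil X (pencil Y Z) - pencil Y (pencil X Z) - pencil (shift_bracket X Y) Z =
    (D' ?LX (D' ?LY Z) - D' ?LY (D' ?LX Z) - D' (m E ?B) Z) - s ?r1
    + s (s (D X (D Y Z) - D Y (D X Z) - D ?b Z))"
    unfolding pencil_def shift_bracket_def by (simp add: linear s_linear algebra_simps)
  also have "\<dots> = 0"
    unfolding r0 r1 r2 using additive_on_zero[of s, OF s_add] by simp
  finally show ?thesis .
qed

lemma pencil_eq:
  assumes [simp]: "X \<in> A" "Y \<in> A"
  shows "pencil X Y = D' (shift X) Y + s (D' X Y - D X Y)"
  by (simp add: pencil_def shift_def linear s_linear)

text \<open>
  The pencil differs from \<open>D' (shift X) Y\<close> by a multiple of \<open>K (X \<star> Y)\<close>, which becomes symmetric after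
  \<open>Y\<close> is replaced by \<open>shift Y\<close>.
\<close>

lemma torsionless_pencil:
  assumes [simp]: "X \<in> A" "Y \<in> A"
  shows "pencil X (shift Y) - pencil Y (shift X) = D (shift X) (shift Y) - D (shift Y) (shift X)"
proof -
  have "pencil X (shift Y) - pencil Y (shift X) = D' (shift X) (shift Y) - D' (shift Y) (shift X) + s (K (m X (shift Y)) - K (m Y (shift X)))"
    by (simp add: pencil_eq D'_eq s_linear algebra_simps)
  also have "m X (shift Y) = m Y (shift X)"
    by (simp add: shift_def linear s_linear m_ac)
  finally show ?thesis using additive_on_zero[of s, OF s_add] by (simp add: same_bracket)
qed

end

section \<open>The Gauss-Manin connection\<close>

context sheaf_of_algebras
begin

lemma biadditive_sheaf_mapD:
  assumes "biadditive_sheaf_map \<O> U B" "open V" "V \<subseteq> U" "X \<in> VF V" "Y \<in> VF V"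
  shows "B V X Y \<in> VF V"
    and "open W \<Longrightarrow> W \<subseteq> V \<Longrightarrow> res W (B V X Y) = B W (res W X) (res W Y)"
    and "Z \<in> VF V \<Longrightarrow> B V (X + Y) Z = B V X Z + B V Y Z"
    and "Z \<in> VF V \<Longrightarrow> B V Z (X + Y) = B V Z X + B V Z Y"
  using assms unfolding biadditive_sheaf_map_def by blast+

lemma biadditive_sheaf_map_diff:
  assumes "biadditive_sheaf_map \<O> U B" "open V" "V \<subseteq> U" "X \<in> VF V" "Y \<in> VF V" "Z \<in> VF V"
  shows "B V (X - Y) Z = B V X Z - B V Y Z" "B V Z (X - Y) = B V Z X - B V Z Y"
  using biadditive_sheaf_mapD(3,4)[OF assms(1-3) VF_diff[OF assms(4,5)] assms(5,6)]
  by simp_all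

lemma bilinear_productD:
  assumes "bilinear_product \<O> U m" "open V" "V \<subseteq> U" "f \<in> \<O> V" "X \<in> VF V" "Y \<in> VF V"
  shows "m V (f \<odot> X) Y = f \<odot> m V X Y" "m V X (f \<odot> Y) = f \<odot> m V X Y"
  using assms unfolding bilinear_product_def by blast+

lemma connectionD:
  assumes "connection \<O> U D" "open V" "V \<subseteq> U" "f \<in> \<O> V" "X \<in> VF V" "Y \<in> VF V"
  shows "D V (f \<odot> X) Y = f \<odot> D V X Y" "D V X (f \<odot> Y) = f \<odot> D V X Y + act X f \<odot> Y"
  using assms unfolding connection_def by blast+

lemma connection_scale_const:
  assumes "connection \<O> U D" "open V" "V \<subseteq> U" "X \<in> VF V" "Y \<in> VF V"
  shows "D V X ((\<lambda>_. c) \<odot> Y) = (\<lambda>_. c) \<odot> D V X Y"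
  using connectionD(2)[OF assms(1-3) sections_const assms(4,5)] act_const[OF assms(4)] by simp

text \<open>
  The pencil condition is used for the constants 0 and 1. Their difference isolates the compatibility of
  the connection with the product, since the quadratic term of the curvature vanishes for a commutative
  associative product.
\<close>

lemma flat_F_manifoldD:
  assumes FF: "flat_F_manifold \<O> U D m e" and V: "open V" "V \<subseteq> U"
    and X: "X \<in> VF V" and Y: "Y \<in> VF V"
  shows "lie \<O> X Y = D V X Y - D V Y X" (is ?lie)
    and "Z \<in> VF V \<Longrightarrow> D V X (D V Y Z) - D V Y (D V X Z) - D V (D V X Y - D V Y X) Z = 0"
      (is "_ \<Longrightarrow> ?flat")
    and "Z \<in> VF V \<Longrightarrow> D V X (m V Y Z) - D V Y (m V X Z) + m V X (D V Y Z) - m V Y (D V X Z)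
           - m V (D V X Y - D V Y X) Z = 0" (is "_ \<Longrightarrow> ?compatible")
    and "D V X (res V e) = 0"
    and "m V X Y = m V Y X"
    and "Z \<in> VF V \<Longrightarrow> m V (m V X Y) Z = m V X (m V Y Z)"
    and "m V (res V e) X = X"
    and "e \<in> VF U"
    and "connection \<O> U D" and "biadditive_sheaf_map \<O> U D"
    and "bilinear_product \<O> U m" and "biadditive_sheaf_map \<O> U m"
proof -
  have Fm: "F_manifold \<O> U m e" and con: "connection \<O> U D"
    and pencil: "\<And>c. flat \<O> U (\<lambda>V X Y. D V X Y - (\<lambda>_. c) \<odot> m V X Y)"
    and tors: "\<And>c. torsionless \<O> U (\<lambda>V X Y. D V X Y - (\<lambda>_. c) \<odot> m V X Y)"
    and par: "\<forall>V. open V \<longrightarrow> V \<subseteq> U \<longrightarrow> (\<forall>X\<in>VF V. D V X (res V e) = 0)"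
    using FF unfolding flat_F_manifold_def by auto
  show "connection \<O> U D" by (rule con)
  then show bD: "biadditive_sheaf_map \<O> U D" unfolding connection_def by blast
  show bp: "bilinear_product \<O> U m" and "e \<in> VF U" using Fm unfolding F_manifold_def by auto
  then show bm: "biadditive_sheaf_map \<O> U m" unfolding bilinear_product_def by blast
  show "D V X (res V e) = 0" using par V X by blast
  show "m V X Y = m V Y X" "m V (res V e) X = X"
    using Fm V X Y unfolding F_manifold_def Let_def by blast+
  have assoc: "m V (m V P Q) R = m V P (m V Q R)"
    and comm: "m V P Q = m V Q P" if "P \<in> VF V" "Q \<in> VF V" "R \<in> VF V" for P Q R
    using Fm V that unfolding F_manifold_def Let_def by blast+
  then show "Z \<in> VF V \<Longrightarrow> m V (m V X Y) Z = m V X (m V Y Z)" using X Y by blast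
  have "D V X Y - D V Y X - lie \<O> X Y = 0"
    using tors[of 0] V X Y unfolding torsionless_def by simp
  then show lie: ?lie by (simp add: algebra_simps)
  show flat: ?flat if Z: "Z \<in> VF V"
    using pencil[of 0] V X Y Z unfolding flat_def lie[symmetric] by simp
  show ?compatible if Z: "Z \<in> VF V"
  proof -
    note cl = X Y Z biadditive_sheaf_mapD(1)[OF bD V] biadditive_sheaf_mapD(1)[OF bm V] VF_diff
    have "m V X (m V Y Z) = m V Y (m V X Z)"
      using assoc[OF X Y Z] assoc[OF Y X Z] comm[OF X Y Z] by simp
    moreover have "D V X (D V Y Z - m V Y Z) - m V X (D V Y Z - m V Y Z)
        - (D V Y (D V X Z - m V X Z) - m V Y (D V X Z - m V X Z))
        - (D V (lie \<O> X Y) Z - m V (lie \<O> X Y) Z) = 0"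
      using pencil[of 1] V X Y Z unfolding flat_def by simp
    ultimately have "D V X (D V Y Z) - D V Y (D V X Z) - D V (D V X Y - D V Y X) Z
       - (D V X (m V Y Z) - D V Y (m V X Z) + m V X (D V Y Z) - m V Y (D V X Z)
         - m V (D V X Y - D V Y X) Z) = 0"
      unfolding lie
      by (simp add: cl biadditive_sheaf_map_diff[OF bD V] biadditive_sheaf_map_diff[OF bm V])
        (simp add: algebra_simps)
    then show ?thesis using flat[OF Z] by simp
  qed
qed

lemma scaled_bi_flat_algebra_vector_fields:
  assumes bf: "bi_flat_F_manifold \<O> D m e U D' m' E" and V: "open V" "V \<subseteq> U"
  shows "scaled_bi_flat_algebra (VF V) (m V) (D V) (D' V) (res V e) (res V E) (\<lambda>X. (\<lambda>_. c) \<odot> X)"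
proof -
  have FF: "flat_F_manifold \<O> UNIV D m e" and Eu: "Euler_field \<O> m e E"
    and FF': "flat_F_manifold \<O> U D' m' (res U E)"
    and dd: "\<And>X Y Z. X \<in> VF V \<Longrightarrow> Y \<in> VF V \<Longrightarrow> Z \<in> VF V \<Longrightarrow>
           D V Y (m V X Z) - D V Z (m V X Y) = D' V Y (m V X Z) - D' V Z (m V X Y)"
    using bf V unfolding bi_flat_F_manifold_def by auto
  have z: "0 \<in> VF V" by (rule VF_I) (simp_all add: tangent_vector_zero sections_const)
  note f = flat_F_manifoldD[OF FF V(1) subset_UNIV]
  note f' = flat_F_manifoldD[OF FF' V]
  note D = biadditive_sheaf_mapD[OF f(10)[OF z z] V(1) subset_UNIV]
  note m = biadditive_sheaf_mapD[OF f(12)[OF z z] V(1) subset_UNIV]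
  note D' = biadditive_sheaf_mapD[OF f'(10)[OF z z] V]
  have E: "E \<in> VF UNIV" using Eu unfolding Euler_field_def by blast
  have EV: "res V E \<in> VF V" by (rule VF_restrict[OF E]) simp
  have eV: "res V e \<in> VF V" by (rule VF_restrict[OF f(8)[OF z z]]) simp
  have rE: "res V (res U E) = res V E" using V by (simp add: res_res Int_absorb2)
  have Euler: "lie \<O> (res V E) (m V X Y) - m V (lie \<O> (res V E) X) Y - m V X (lie \<O> (res V E) Y)
        = m V X Y" if "X \<in> VF V" "Y \<in> VF V" for X Y
    using Eu that V unfolding Euler_field_def by blast
  show ?thesis
  proof
    show "res V e \<in> VF V" "res V E \<in> VF V" by (fact eV EV)+
    fix X Y assume X: "X \<in> VF V" and Y: "Y \<in> VF V"
    show "X - Y \<in> VF V" "(\<lambda>_. c) \<odot> X \<in> VF V" by (intro VF_diff VF_scale_const X Y)+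
    show "m V X Y \<in> VF V" "D V X Y \<in> VF V" "D' V X Y \<in> VF V"
      by (rule m(1) D(1) D'(1), fact X, fact Y)+
    show "m V X Y = m V Y X" by (rule f(5)[OF X Y])
    show "m V (res V e) X = X" by (rule f(7)[OF X Y])
    show "D' V X Y - D' V Y X = D V X Y - D V Y X"
      using f(1)[OF X Y] f'(1)[OF X Y] by simp
    show "D V X (res V e) = 0" by (rule f(4)[OF X Y])
    show "D' V X (res V E) = 0" using f'(4)[OF X Y] by (simp add: rE)
    have mXY: "m V X Y \<in> VF V" by (rule m(1)[OF X Y])
    show "D V (res V E) (m V X Y) - D V (m V X Y) (res V E)
        - m V (D V (res V E) X - D V X (res V E)) Y - m V X (D V (res V E) Y - D V Y (res V E)) = m V X Y"
      using Euler[OF X Y] by (simp add: f(1)[OF EV X] f(1)[OF EV Y] f(1)[OF EV mXY])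
    show "(\<lambda>_. c) \<odot> (X + Y) = (\<lambda>_. c) \<odot> X + (\<lambda>_. c) \<odot> Y" by (rule scale_add)
    show "m V X ((\<lambda>_. c) \<odot> Y) = (\<lambda>_. c) \<odot> m V X Y"
      by (rule bilinear_productD(2)[OF f(11)[OF z z] V(1) subset_UNIV sections_const X Y])
    show "D V X ((\<lambda>_. c) \<odot> Y) = (\<lambda>_. c) \<odot> D V X Y"
      by (rule connection_scale_const[OF f(9)[OF z z] V(1) subset_UNIV X Y])
    show "D' V X ((\<lambda>_. c) \<odot> Y) = (\<lambda>_. c) \<odot> D' V X Y"
      by (rule connection_scale_const[OF f'(9)[OF z z] V X Y])
    show "D V ((\<lambda>_. c) \<odot> X) Y = (\<lambda>_. c) \<odot> D V X Y"
      by (rule connectionD(1)[OF f(9)[OF z z] V(1) subset_UNIV sections_const X Y])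
    show "D' V ((\<lambda>_. c) \<odot> X) Y = (\<lambda>_. c) \<odot> D' V X Y"
      by (rule connectionD(1)[OF f'(9)[OF z z] V sections_const X Y])
    fix Z assume Z: "Z \<in> VF V"
    show "m V X (Y + Z) = m V X Y + m V X Z" by (rule m(4)[OF Y Z X])
    show "D V X (Y + Z) = D V X Y + D V X Z" by (rule D(4)[OF Y Z X])
    show "D V (X + Y) Z = D V X Z + D V Y Z" by (rule D(3)[OF X Y Z])
    show "D' V X (Y + Z) = D' V X Y + D' V X Z" by (rule D'(4)[OF Y Z X])
    show "D' V (X + Y) Z = D' V X Z + D' V Y Z" by (rule D'(3)[OF X Y Z])
    show "m V (m V X Y) Z = m V X (m V Y Z)" by (rule f(6)[OF X Y Z])
    show "D V X (D V Y Z) - D V Y (D V X Z) - D V (D V X Y - D V Y X) Z = 0"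
      by (rule f(2)[OF X Y Z])
    show "D' V X (D' V Y Z) - D' V Y (D' V X Z) - D' V (D' V X Y - D' V Y X) Z = 0"
      by (rule f'(2)[OF X Y Z])
    show "D V X (m V Y Z) - D V Y (m V X Z) + m V X (D V Y Z) - m V Y (D V X Z)
           - m V (D V X Y - D V Y X) Z = 0"
      by (rule f(3)[OF X Y Z])
    show "D V Y (m V X Z) - D V Z (m V X Y) = D' V Y (m V X Z) - D' V Z (m V X Y)"
      by (rule dd[OF X Y Z])
  qed
qed

end

theorem theorem3p2:
  fixes reg :: regularity
    and \<A> :: "('m::{t2_space, second_countable_topology} set \<times>
                ('m \<Rightarrow> 'k::real_normed_field ^ 'n::finite)) set"
    and \<O> :: "('m, 'k) function_sheaf"
    and D D' m m' :: "('m, 'k) operation"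
    and e E :: "('m, 'k) vfield"
    and U :: "'m set"
    and L :: "('m, 'k) endo"
    and lam :: 'k
    and \<Omega> :: "'m set"
  assumes "manifold reg \<A>"
    and "\<O> = structure_sheaf reg \<A>"
    and "bi_flat_F_manifold \<O> D m e U D' m' E"
    and "L = mult_endo m E"
    and "\<Omega> = invertible_locus \<O> U (shift_endo L lam)"
  shows "connection \<O> \<Omega> (nabla_GM \<O> L lam D D') \<and>
         flat \<O> \<Omega> (nabla_GM \<O> L lam D D') \<and>
         torsionless \<O> \<Omega> (nabla_GM \<O> L lam D D')"
proof -
  interpret sheaf_of_algebras \<O>
    unfolding assms(2) by (rule sheaf_of_algebras_structure_sheaf[OF assms(1)])
  note bf = assms(3)
  let ?F = "shift_endo L lam" and ?N = "nabla_GM \<O> L lam D D'" and ?s = "\<lambda>X. (\<lambda>_. lam) \<odot> X"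
  have F: "?F V X = m V (res V E) X - ?s X" for V X
    by (simp add: shift_endo_def assms(4) mult_endo_def)
  have FF: "flat_F_manifold \<O> UNIV D m e" and FF': "flat_F_manifold \<O> U D' m' (res U E)"
    and E: "E \<in> VF UNIV"
    using bf unfolding bi_flat_F_manifold_def Euler_field_def by auto
  have con: "connection \<O> UNIV D" and con': "connection \<O> U D'" and bp: "bilinear_product \<O> UNIV m"
    using FF FF' unfolding flat_F_manifold_def F_manifold_def by auto
  then have bD: "biadditive_sheaf_map \<O> UNIV D" and bD': "biadditive_sheaf_map \<O> U D'"
    and bm: "biadditive_sheaf_map \<O> UNIV m"
    unfolding connection_def bilinear_product_def by auto
  have EV: "res V E \<in> VF V" for V by (rule VF_restrict[OF E]) simp
  interpret sheaf_endomorphism \<O> U ?F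
  proof
    fix V X assume V: "open V" "V \<subseteq> U" and X: "X \<in> VF V"
    note m = biadditive_sheaf_mapD[OF bm V(1) subset_UNIV]
    show "?F V X \<in> VF V"
      unfolding F by (intro VF_diff VF_scale_const m(1) X EV)
    show "res W (?F V X) = ?F W (res W X)" if "open W" "W \<subseteq> V" for W
      unfolding F res_diff res_scale using that by (simp add: m(2)[OF EV X] res_res Int_absorb2)
    show "?F V (X + Y) = ?F V X + ?F V Y" if "Y \<in> VF V" for Y
      unfolding F by (simp add: m(4)[OF X that EV] scale_add)
    show "?F V (f \<odot> X) = f \<odot> ?F V X" if "f \<in> \<O> V" for f
      unfolding F
      by (simp add: bilinear_productD(2)[OF bp V(1) subset_UNIV that EV X] scale_diff scale_commute)
  qed
  let ?G = "inverse_endo \<O> ?F"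
  have N: "?N V X Y = D' V X Y + ?s (D' V (?G V X) Y - D V (?G V X) Y)" for V X Y
    by (simp add: nabla_GM_def Let_def)
  note \<Omega> = assms(5)

  have "connection \<O> \<Omega> ?N"
    unfolding connection_def biadditive_sheaf_map_def
  proof (intro conjI allI impI ballI)
    fix V X Y assume V: "open V" "V \<subseteq> \<Omega>" and X: "X \<in> VF V" and Y: "Y \<in> VF V"
    have V': "V \<subseteq> invertible_locus \<O> U ?F" "V \<subseteq> U"
      using V \<Omega> invertible_locus_subset by auto
    note D = biadditive_sheaf_mapD[OF bD V(1) subset_UNIV]
    note D' = biadditive_sheaf_mapD[OF bD' V(1) V'(2)]
    note GVF = inverse_endo_VF[OF V(1) V'(1)]
    show "?N V X Y \<in> VF V"
      unfolding N by (intro VF_add VF_diff VF_scale_const D(1) D'(1) X Y GVF)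
    show "res W (?N V X Y) = ?N W (res W X) (res W Y)" if "open W" "W \<subseteq> V" for W
      unfolding N res_add res_scale res_diff
      by (simp add: D(2)[OF GVF[OF X] Y that] D'(2)[OF X Y that] D'(2)[OF GVF[OF X] Y that]
          inverse_endo_res[OF V(1) V'(1) that X])
    show "?N V (X + Y) Z = ?N V X Z + ?N V Y Z" if Z: "Z \<in> VF V" for Z
      unfolding N inverse_endo_add[OF V(1) V'(1) X Y] D'(3)[OF X Y Z] D(3)[OF GVF[OF X] GVF[OF Y] Z]
        D'(3)[OF GVF[OF X] GVF[OF Y] Z] scale_add scale_diff
      by (simp add: algebra_simps)
    show "?N V Z (X + Y) = ?N V Z X + ?N V Z Y" if Z: "Z \<in> VF V" for Z
      unfolding N D'(4)[OF X Y Z] D(4)[OF X Y GVF[OF Z]] D'(4)[OF X Y GVF[OF Z]] scale_add scale_diff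
      by (simp add: algebra_simps)
  next
    fix V f X Y assume V: "open V" "V \<subseteq> \<Omega>" and f: "f \<in> \<O> V" and X: "X \<in> VF V" and Y: "Y \<in> VF V"
    have V': "V \<subseteq> invertible_locus \<O> U ?F" "V \<subseteq> U"
      using V \<Omega> invertible_locus_subset by auto
    note D = connectionD[OF con V(1) subset_UNIV f]
    note D' = connectionD[OF con' V(1) V'(2) f]
    note GX = inverse_endo_VF[OF V(1) V'(1) X]
    show "?N V (f \<odot> X) Y = f \<odot> ?N V X Y"
      unfolding N inverse_endo_scale[OF V(1) V'(1) f X] D(1)[OF GX Y] D'(1)[OF GX Y] D'(1)[OF X Y]
      by (simp add: scale_add scale_diff scale_commute)
    show "?N V X (f \<odot> Y) = f \<odot> ?N V X Y + act X f \<odot> Y"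
      unfolding N D(2)[OF GX Y] D'(2)[OF GX Y] D'(2)[OF X Y]
      by (simp add: scale_add scale_diff scale_commute[of f])
  qed
  moreover have "flat \<O> \<Omega> ?N \<and> torsionless \<O> \<Omega> ?N"
    unfolding flat_def torsionless_def
  proof (intro conjI allI impI ballI)
    fix V X Y assume V: "open V" "V \<subseteq> \<Omega>" and X: "X \<in> VF V" and Y: "Y \<in> VF V"
    have V': "V \<subseteq> invertible_locus \<O> U ?F" "V \<subseteq> U"
      using V \<Omega> invertible_locus_subset by auto
    interpret scaled_bi_flat_algebra "VF V" "m V" "D V" "D' V" "res V e" "res V E" ?s
      by (rule scaled_bi_flat_algebra_vector_fields[OF bf V(1) V'(2)])
    have shift: "shift = ?F V" by (simp add: fun_eq_iff shift_def F)
    \<comment> \<open>Since \<open>shift\<close> is bijective, it suffices to know the connection on fields of the form \<open>shift X\<close>.\<close>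
    have nabla_shift: "?N V (shift X) Z = pencil X Z" if "X \<in> VF V" "Z \<in> VF V" for X Z
      unfolding N shift inverse_endo_endo[OF V(1) V'(1) that(1)] using pencil_eq[OF that] shift by simp
    obtain X' Y' where X': "X' \<in> VF V" "X = shift X'" and Y': "Y' \<in> VF V" "Y = shift Y'"
      unfolding shift using inverse_endo_VF[OF V(1) V'(1)] endo_inverse_endo[OF V(1) V'(1)] X Y by metis
    have lie: "lie \<O> X Y = D V X Y - D V Y X"
      by (rule flat_F_manifoldD(1)[OF FF V(1) subset_UNIV X Y])
    show "?N V X Y - ?N V Y X - lie \<O> X Y = 0"
      unfolding lie using X' Y' X Y by (simp add: nabla_shift torsionless_pencil)
    show "?N V X (?N V Y Z) - ?N V Y (?N V X Z) - ?N V (lie \<O> X Y) Z = 0" if Z: "Z \<in> VF V" for Z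
    proof -
      have pencil_VF: "pencil X Z \<in> VF V" if "X \<in> VF V" for X using that Z by (simp add: pencil_def)
      have "lie \<O> X Y = shift (shift_bracket X' Y')" unfolding lie using X' Y' by (simp add: bracket_shift)
      then show ?thesis
        using X' Y' Z pencil_VF by (simp add: nabla_shift flat_pencil)
    qed
  qed
  ultimately show ?thesis by blast
qed

end
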